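(* Let $\theta\in(0,1]$ and let $(Z_n)_{n\ge 0}$ be a power-fractional Galton-Watson process with one ancestor in the iid random environment $\mathbf{e}=(\mathbf e_n)_{n\ge 1}=((A_n,B_n))_{n\ge 1}$ with quenched offspring laws $\mathsf{PF}(\theta,A_n,B_n)$, as described in the context. Suppose the process is supercritical, so that $R_\infty<\infty=R_\infty^{(-1)}$ a.s. Then: (a) The quenched extinction probability $q(\mathbf e)$ is given by $$q(\mathbf e)=1-R_\infty^{-1/\theta}\quad\text{a.s.},$$ and $\mathbb{P}(q(\mathbf e)<1)=1$. Moreover, $$\frac{1}{(1-q(\mathbf e))^{\theta}}=\frac{A_1}{(1-q(\mathbf e_{\ge 2}))^{\theta}}+B_1\quad\text{a.s.}$$ (b) For almost all realizations of $\mathbf e$, the sequence $W_n=\Pi_n^{1/\theta}Z_n$, $n\ge 0$, is a nonnegative martingale with mean $1$ under the quenched probability measure $\mathbf P=\mathbb{P}(\cdot|\mathbf e)$, and as $n\to\infty$ it converges a.s. and in $L^1$ to a random variable $W_\infty$ with quenched law $\mathsf{CPF}(\theta,1,R_\infty)$, having Laplace transform $$\varphi(\mathbf e,u)=\mathbf E e^{-uW_\infty}=1-\Big[\frac{1}{u^{\theta}}+R_\infty\Big]^{-1/\theta},\qquad u\ge 0,$$ which satisfies $$\varphi(\mathbf e,u)=f_1\big(\varphi(\mathbf e_{\ge 2},A_1^{1/\theta}u)\big)\quad\text{a.s.}$$ for all $u\ge 0$.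
   Context: For $\theta\in(0,1]$ and $a,b>0$ with $a+b\ge 1$, $\mathsf{PF}(\theta,a,b)$ is the probability distribution on $\mathbb{N}_0$ with probability generating function $s\mapsto 1-\big[\frac{a}{(1-s)^{\theta}}+b\big]^{-1/\theta}$, $s\in[0,1)$ (value $1$ at $s=1$). For $\theta\in(0,1]$, $\alpha>0$, $\beta\ge 1$, $\mathsf{CPF}(\theta,\alpha,\beta)$ is the law on $[0,\infty)$ with Laplace transform $u\mapsto 1-[\alpha u^{-\theta}+\beta]^{-1/\theta}$ (value $1$ at $u=0$). Setting: $\mathbf e_n=(A_n,B_n)$, $n\ge 1$, are iid random vectors with $\mathbb{P}(A_n>0,\,B_n>0,\,A_n+B_n\ge 1)=1$. Given $\mathbf e$, $(Z_n)_{n\ge 0}$ is a branching process with $Z_0=1$ in which individuals of generation $n-1$ independently produce offspring with law $\mathsf{PF}(\theta,A_n,B_n)$, whose (random) generating function is $f_n$. $\mathbf P=\mathbb{P}(\cdot|\mathbf e)$ with expectation $\mathbf E$; $\mathbf e_{1:n}=(\mathbf e_1,\dots,\mathbf e_n)$ and $\mathbf e_{\ge n}=(\mathbf e_n,\mathbf e_{n+1},\dots)$. The quenched extinction probability is $q(\mathbf e)=\lim_{n\to\infty}\mathbb{P}(Z_n=0|\mathbf e_{1:n})$; $q(\mathbf e_{\ge 2})$ and $\varphi(\mathbf e_{\ge 2},\cdot)$ are the same functionals evaluated at the shifted environment. Put $\Pi_0=1$, $\Pi_n=\prod_{k=1}^nA_k$, $R_n=\sum_{k=1}^n\Pi_{k-1}B_k$,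 $R_n^{(-1)}=\sum_{k=1}^n\Pi_k^{-1}B_k$, $R_\infty=\sum_{k\ge 1}\Pi_{k-1}B_k$, $R_\infty^{(-1)}=\sum_{k\ge1}\Pi_k^{-1}B_k$. The supercritical hypothesis means here that $R_\infty<\infty=R_\infty^{(-1)}$ a.s. *)

theory Defs
  imports "HOL-Probability.Probability"
begin

section \<open>Power-fractional laws\<close>

text \<open>The case distinction is needed because division by zero yields zero in HOL, so the formula
  itself does not produce the value \<open>1\<close> at \<open>s = 1\<close>; likewise for \<open>CPF_laplace\<close> at \<open>u = 0\<close>.\<close>

definition PF_pgf :: "real \<Rightarrow> real \<Rightarrow> real \<Rightarrow> real \<Rightarrow> real" where
  "PF_pgf \<theta> a b s =
     (if s = 1 then 1 else 1 - (a / (1 - s) powr \<theta> + b) powr (- 1 / \<theta>))"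

definition PF_law :: "real \<Rightarrow> real \<Rightarrow> real \<Rightarrow> nat measure \<Rightarrow> bool" where
  "PF_law \<theta> a b N \<longleftrightarrow>
     0 < \<theta> \<and> \<theta> \<le> 1 \<and> 0 < a \<and> 0 < b \<and> 1 \<le> a + b \<and>
     prob_space N \<and> sets N = sets (count_space UNIV) \<and>
     (\<forall>s\<in>{0..1}. (\<integral>k. s ^ k \<partial>N) = PF_pgf \<theta> a b s)"

definition CPF_laplace :: "real \<Rightarrow> real \<Rightarrow> real \<Rightarrow> real \<Rightarrow> real" where
  "CPF_laplace \<theta> \<alpha> \<beta> u =
     (if u = 0 then 1 else 1 - (\<alpha> * u powr (- \<theta>) + \<beta>) powr (- 1 / \<theta>))"

definition CPF_law :: "real \<Rightarrow> real \<Rightarrow> real \<Rightarrow> real measure \<Rightarrow> bool" where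
  "CPF_law \<theta> \<alpha> \<beta> N \<longleftrightarrow>
     0 < \<theta> \<and> \<theta> \<le> 1 \<and> 0 < \<alpha> \<and> 1 \<le> \<beta> \<and>
     prob_space N \<and> sets N = sets borel \<and> (AE x in N. 0 \<le> x) \<and>
     (\<forall>u\<ge>0. (\<integral>x. exp (- u * x) \<partial>N) = CPF_laplace \<theta> \<alpha> \<beta> u)"


section \<open>Environments\<close>

text \<open>Environments are indexed from \<open>0\<close>: \<open>\<eta> k\<close> is the pair usually written
  \<open>(A_{k+1}, B_{k+1})\<close>, the parameters of the offspring law of the individuals of
  generation \<open>k\<close>.\<close>

type_synonym env = "nat \<Rightarrow> real \<times> real"

abbreviation env_space :: "env measure" where
  "env_space \<equiv> PiM UNIV (\<lambda>_. borel)"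

definition envA :: "env \<Rightarrow> nat \<Rightarrow> real" where "envA \<eta> k = fst (\<eta> k)"
definition envB :: "env \<Rightarrow> nat \<Rightarrow> real" where "envB \<eta> k = snd (\<eta> k)"

text \<open>The shifted environment, starting with the second pair.\<close>

definition env_shift :: "env \<Rightarrow> env" where "env_shift \<eta> = (\<lambda>k. \<eta> (Suc k))"

definition Pi_env :: "env \<Rightarrow> nat \<Rightarrow> real" where
  "Pi_env \<eta> n = (\<Prod>k<n. envA \<eta> k)"

text \<open>The \<open>k\<close>-th summands of \<open>R\<^sub>\<infinity>\<close> and of its dual; with one-based indices they are
  \<open>\<Pi>_{k-1} B_k\<close> and \<open>B_k / \<Pi>_k\<close>. They are positive for almost every environment, so that
  finiteness of the series is summability.\<close>

definition R_term :: "env \<Rightarrow> nat \<Rightarrow> real" where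
  "R_term \<eta> k = Pi_env \<eta> k * envB \<eta> k"

definition Rdual_term :: "env \<Rightarrow> nat \<Rightarrow> real" where
  "Rdual_term \<eta> k = inverse (Pi_env \<eta> (Suc k)) * envB \<eta> k"

definition R_inf :: "env \<Rightarrow> real" where
  "R_inf \<eta> = (\<Sum>k. R_term \<eta> k)"


section \<open>Random environments and quenched measures\<close>

abbreviation env_of :: "(nat \<Rightarrow> 'a \<Rightarrow> real \<times> real) \<Rightarrow> 'a \<Rightarrow> env" where
  "env_of e \<omega> \<equiv> (\<lambda>k. e k \<omega>)"

definition sigma_env :: "'a measure \<Rightarrow> (nat \<Rightarrow> 'a \<Rightarrow> real \<times> real) \<Rightarrow> 'a measure" where
  "sigma_env M e = vimage_algebra (space M) (env_of e) env_space"

text \<open>The sigma-algebra generated by the first \<open>n\<close> pairs of the environment.\<close>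

definition sigma_env_upto :: "'a measure \<Rightarrow> (nat \<Rightarrow> 'a \<Rightarrow> real \<times> real) \<Rightarrow> nat \<Rightarrow> 'a measure" where
  "sigma_env_upto M e n =
     vimage_algebra (space M) (\<lambda>\<omega>. \<lambda>k\<in>{..<n}. e k \<omega>) (PiM {..<n} (\<lambda>_. borel))"

definition iid_env :: "'a measure \<Rightarrow> (nat \<Rightarrow> 'a \<Rightarrow> real \<times> real) \<Rightarrow> bool" where
  "iid_env M e \<longleftrightarrow>
     prob_space.indep_vars M (\<lambda>_. borel) e UNIV \<and>
     (\<forall>n. distr M borel (e n) = distr M borel (e 0))"

text \<open>\<open>P\<close> is a regular version of the conditional probability given the environment. It is a
  kernel on environments rather than on the sample space, so that quenched functionals can also
  be evaluated at the shifted environment.\<close>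

definition quenched_measure ::
    "'a measure \<Rightarrow> (nat \<Rightarrow> 'a \<Rightarrow> real \<times> real) \<Rightarrow> (env \<Rightarrow> 'a measure) \<Rightarrow> bool" where
  "quenched_measure M e P \<longleftrightarrow>
     P \<in> measurable env_space (prob_algebra M) \<and>
     (\<forall>S\<in>sets M. AE \<omega> in M.
        real_cond_exp M (sigma_env M e) (indicator S) \<omega> = measure (P (env_of e \<omega>)) S)"


section \<open>The branching process\<close>

text \<open>\<open>X n k\<close> is the number of children of the \<open>k\<close>-th potential individual of generation \<open>n\<close>.\<close>

primrec GW :: "(nat \<Rightarrow> nat \<Rightarrow> 'a \<Rightarrow> nat) \<Rightarrow> nat \<Rightarrow> 'a \<Rightarrow> nat" where
  "GW X 0 \<omega> = 1"
| "GW X (Suc n) \<omega> = (\<Sum>k<GW X n \<omega>. X n k \<omega>)"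

definition PF_offspring ::
    "real \<Rightarrow> env \<Rightarrow> 'a measure \<Rightarrow> (nat \<Rightarrow> nat \<Rightarrow> 'a \<Rightarrow> nat) \<Rightarrow> bool" where
  "PF_offspring \<theta> \<eta> N X \<longleftrightarrow>
     prob_space.indep_vars N (\<lambda>_. count_space UNIV) (\<lambda>(n, k). X n k) UNIV \<and>
     (\<forall>n k. PF_law \<theta> (envA \<eta> n) (envB \<eta> n) (distr N (count_space UNIV) (X n k)))"

text \<open>The functional \<open>q\<close> is only determined up to null sets of environments, because conditional
  probabilities are; every measurable version is admitted.\<close>

definition quenched_extinction_prob ::
    "'a measure \<Rightarrow> (nat \<Rightarrow> 'a \<Rightarrow> real \<times> real) \<Rightarrow> (nat \<Rightarrow> nat \<Rightarrow> 'a \<Rightarrow> nat)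
      \<Rightarrow> (env \<Rightarrow> real) \<Rightarrow> bool" where
  "quenched_extinction_prob M e X q \<longleftrightarrow>
     q \<in> borel_measurable env_space \<and>
     (AE \<omega> in M.
        (\<lambda>n. real_cond_exp M (sigma_env_upto M e n)
               (indicator {\<omega>' \<in> space M. GW X n \<omega>' = 0}) \<omega>)
          \<longlonglongrightarrow> q (env_of e \<omega>))"

definition W_proc ::
    "real \<Rightarrow> (nat \<Rightarrow> 'a \<Rightarrow> real \<times> real) \<Rightarrow> (nat \<Rightarrow> nat \<Rightarrow> 'a \<Rightarrow> nat) \<Rightarrow> nat \<Rightarrow> 'a \<Rightarrow> real" where
  "W_proc \<theta> e X n \<omega> = Pi_env (env_of e \<omega>) n powr (1 / \<theta>) * real (GW X n \<omega>)"

text \<open>The history up to generation \<open>n\<close>: the sigma-algebra generated by the environment (which is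
  almost surely constant under a quenched measure) and \<open>Z_0, ..., Z_n\<close>.\<close>

definition GW_filtration ::
    "'a measure \<Rightarrow> (nat \<Rightarrow> 'a \<Rightarrow> real \<times> real) \<Rightarrow> (nat \<Rightarrow> nat \<Rightarrow> 'a \<Rightarrow> nat) \<Rightarrow> nat \<Rightarrow> 'a measure" where
  "GW_filtration M e X n =
     vimage_algebra (space M) (\<lambda>\<omega>. (env_of e \<omega>, \<lambda>k\<in>{..n}. GW X k \<omega>))
       (env_space \<Otimes>\<^sub>M PiM {..n} (\<lambda>_. count_space UNIV))"

definition is_martingale ::
    "'a measure \<Rightarrow> (nat \<Rightarrow> 'a measure) \<Rightarrow> (nat \<Rightarrow> 'a \<Rightarrow> real) \<Rightarrow> bool" where
  "is_martingale N F Y \<longleftrightarrow>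
     (\<forall>n. subalgebra N (F n)) \<and>
     (\<forall>m n. m \<le> n \<longrightarrow> sets (F m) \<subseteq> sets (F n)) \<and>
     (\<forall>n. Y n \<in> borel_measurable (F n)) \<and>
     (\<forall>n. integrable N (Y n)) \<and>
     (\<forall>m n. m \<le> n \<longrightarrow> (AE \<omega> in N. real_cond_exp N (F m) (Y n) \<omega> = Y m \<omega>))"

definition quenched_laplace ::
    "(env \<Rightarrow> 'a measure) \<Rightarrow> ('a \<Rightarrow> real) \<Rightarrow> env \<Rightarrow> real \<Rightarrow> real" where
  "quenched_laplace P W \<eta> u = (\<integral>\<omega>. exp (- u * W \<omega>) \<partial>P \<eta>)"

end

theory Submission
  imports Defs
begin

text \<open>Power-fractional generating functions compose explicitly, so given the environment
  \<open>Z\<^sub>n\<close> has the generating function with parameters \<open>\<Pi>\<^sub>n\<close> and \<open>R\<^sub>n\<close>. The sums \<open>\<Pi>\<^sub>n + R\<^sub>n\<close> are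
  nondecreasing, and divergence of the dual series forces \<open>\<Pi>\<^sub>n \<longlonglongrightarrow> 0\<close>; evaluation at \<open>0\<close> yields the
  extinction probability. As \<open>W\<^sub>n\<close> need not be bounded in \<open>L\<^sup>2\<close>, its almost sure convergence is
  derived from that of a bounded martingale \<open>s\<^sub>n ^ Z\<^sub>n\<close>, where the numbers \<open>s\<^sub>n\<close> solve
  \<open>f\<^sub>n\<^sub>+\<^sub>1 s\<^sub>n\<^sub>+\<^sub>1 = s\<^sub>n\<close>. The Laplace transform of the limit is explicit, its slope at \<open>0\<close> gives mean
  \<open>1\<close>, and Scheffe's lemma gives convergence in \<open>L\<^sup>1\<close>. The two recursions follow from the
  explicit formulas, because the shifted environment has the same law.\<close>

section \<open>Power-fractional generating functions\<close>

text \<open>The explicit composition has one cause: in the coordinate x = 1 / (1 - s) powr \<theta>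
  the map \<open>PF_pgf \<theta> a b\<close> is the affine map sending x to a * x + b. So \<Pi>_n
  and R_n are slope and intercept of a composition of random affine maps, s = 0 is the point x = 1,
  s = 1 is the point at infinity, and A + B \<ge> 1 says that x = 1 is never moved down.

  Second moments are missing because for \<theta> < 1 the remainder of the offspring generating
  function at 1 has order (1 - s) powr (1 + \<theta>), which makes the variance infinite.

  Null sets shape the rest. Conditional probabilities are given only almost surely, so one
  environment is fixed outside a null set and studied under a single measure for which the
  environment is almost surely constant. Quenched functionals at the shifted environment are reached
  only through equality of laws, and the limit has to be one random variable chosen before the
  environment.\<close>

lemma powr_neg_inverse_powr:
  fixes x \<theta> :: real
  assumes "0 < x" "0 < \<theta>"
  shows "(x powr (- 1 / \<theta>)) powr \<theta> = 1 / x"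
  using assms powr_powr[of x "- 1 / \<theta>" \<theta>] by (simp add: powr_minus_divide)

text \<open>The outer affine map sends \<open>a * x + b\<close> to
  \<open>c * (a * x + b) + d\<close>. Only \<open>s \<le> 1\<close> is assumed because Laplace
  transforms are inserted later at \<open>1 - u\<close> with arbitrary \<open>u > 0\<close>.\<close>

lemma PF_pgf_compose:
  assumes "0 < \<theta>" "0 < a" "0 \<le> b" "s \<le> 1"
  shows "PF_pgf \<theta> c d (PF_pgf \<theta> a b s) = PF_pgf \<theta> (c * a) (d + c * b) s"
proof (cases "s = 1")
  case False
  define x where "x = a / (1 - s) powr \<theta> + b"
  have x: "0 < x"
    unfolding x_def using assms False by (intro add_pos_nonneg divide_pos_pos) auto
  show ?thesis
    using False x powr_neg_inverse_powr[OF x \<open>0 < \<theta>\<close>]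
    by (simp add: PF_pgf_def x_def[symmetric]) (simp add: x_def algebra_simps)
qed (simp add: PF_pgf_def)

text \<open>The identity, with parameters \<open>Pi_env \<eta> 0\<close> and
  \<open>R_part \<eta> 0\<close>: the base case of the inductions over generations.\<close>

lemma PF_pgf_0_1: "s \<le> 1 \<Longrightarrow> 0 < \<theta> \<Longrightarrow> PF_pgf \<theta> 1 0 s = s"
  by (auto simp: PF_pgf_def powr_powr powr_minus powr_divide field_simps)

text \<open>Factoring \<open>u n powr (- \<theta>)\<close> out of the bracket cancels the pole
  exactly. The slope at 1 gives the offspring mean and also the mean of the limit, whose Laplace
  transform at \<open>u\<close> is \<open>PF_pgf \<theta> 1 (R_inf \<eta>) (1 - u)\<close>.\<close>

lemma tendsto_PF_pgf_slope:
  fixes u :: "nat \<Rightarrow> real"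
  assumes \<theta>: "0 < \<theta>" and a: "0 < a" and b: "0 \<le> b"
    and u: "u \<longlonglongrightarrow> 0" "\<And>n. 0 < u n"
  shows "(\<lambda>n. (1 - PF_pgf \<theta> a b (1 - u n)) / u n) \<longlonglongrightarrow> a powr (- 1 / \<theta>)"
proof -
  have "(\<lambda>n. (a + b * u n powr \<theta>) powr (- 1 / \<theta>)) \<longlonglongrightarrow> (a + b * 0 powr \<theta>) powr (- 1 / \<theta>)"
    using u a \<theta>
    by (intro tendsto_powr[OF _ tendsto_const] tendsto_add tendsto_mult tendsto_const tendsto_powr2)
       (auto intro!: always_eventually less_imp_le)
  moreover have "(1 - PF_pgf \<theta> a b (1 - u n)) / u n = (a + b * u n powr \<theta>) powr (- 1 / \<theta>)" for n
  proof -
    have pos: "0 < a + b * u n powr \<theta>"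
      using a b by (intro add_pos_nonneg) auto
    have "a / u n powr \<theta> + b = (a + b * u n powr \<theta>) * u n powr (- \<theta>)"
      using u(2)[of n] by (simp add: powr_minus field_simps)
    then have "(a / u n powr \<theta> + b) powr (- 1 / \<theta>) = (a + b * u n powr \<theta>) powr (- 1 / \<theta>) * u n"
      using pos u(2)[of n] \<theta> by (simp add: powr_mult powr_powr)
    then show ?thesis
      using u(2)[of n] by (simp add: PF_pgf_def)
  qed
  ultimately show ?thesis
    using \<theta> by simp
qed

text \<open>The pointwise bound replaces monotonicity in the monotone convergence theorem; one
  inequality is Fatou's lemma.\<close>

lemma nn_integral_limit_from_below:
  fixes g :: "nat \<Rightarrow> 'a \<Rightarrow> ennreal"
  assumes [measurable]: "\<And>n. g n \<in> borel_measurable M"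
    and le: "\<And>n. AE x in M. g n x \<le> f x"
    and lim: "AE x in M. (\<lambda>n. g n x) \<longlonglongrightarrow> f x"
    and int: "(\<lambda>n. \<integral>\<^sup>+x. g n x \<partial>M) \<longlonglongrightarrow> c"
  shows "(\<integral>\<^sup>+x. f x \<partial>M) = c"
proof (rule antisym)
  have "(\<integral>\<^sup>+x. f x \<partial>M) = (\<integral>\<^sup>+x. liminf (\<lambda>n. g n x) \<partial>M)"
    using lim by (intro nn_integral_cong_AE) (auto dest!: lim_imp_Liminf[rotated])
  also have "\<dots> \<le> liminf (\<lambda>n. \<integral>\<^sup>+x. g n x \<partial>M)"
    by (rule nn_integral_liminf) measurable
  also have "\<dots> = c"
    using int by (rule lim_imp_Liminf[rotated]) simp
  finally show "(\<integral>\<^sup>+x. f x \<partial>M) \<le> c" .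
  show "c \<le> (\<integral>\<^sup>+x. f x \<partial>M)"
    using int by (rule LIMSEQ_le_const2) (auto intro!: exI[of _ 0] nn_integral_mono_AE le)
qed

lemma real_geometric_le:
  fixes s :: real
  assumes "0 \<le> s" "s < 1"
  shows "(1 - s ^ k) / (1 - s) \<le> real k"
proof -
  have "(1 - s ^ k) / (1 - s) = (\<Sum>i<k. s ^ i)"
    using assms by (simp add: sum_gp_strict)
  also have "\<dots> \<le> (\<Sum>i<k. 1)"
    using assms by (intro sum_mono power_le_one) auto
  finally show ?thesis by simp
qed

lemma tendsto_geometric_slope:
  fixes s :: "nat \<Rightarrow> real"
  assumes "s \<longlonglongrightarrow> 1" "\<And>n. s n < 1"
  shows "(\<lambda>n. (1 - s n ^ k) / (1 - s n)) \<longlonglongrightarrow> real k"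
proof -
  have "(\<lambda>n. \<Sum>i<k. s n ^ i) \<longlonglongrightarrow> (\<Sum>i<k. 1 ^ i)"
    using assms by (intro tendsto_intros)
  then show ?thesis
    using assms(2) by (simp add: sum_gp_strict less_imp_neq)
qed

text \<open>The quotients \<open>(1 - s ^ k) / (1 - s)\<close> approach \<open>k\<close> from below
  as \<open>s\<close> tends to 1, and they integrate to difference quotients of the generating
  function. With an extended integral, finiteness of the mean is a result and not a
  presupposition.\<close>

lemma PF_law_mean:
  assumes "PF_law \<theta> a b N"
  shows "(\<integral>\<^sup>+k. of_nat k \<partial>N) = ennreal (a powr (- 1 / \<theta>))"
proof -
  interpret prob_space N using assms by (simp add: PF_law_def)
  have sets[measurable_cong]: "sets N = sets (count_space UNIV)"
    and pgf: "\<And>s. 0 \<le> s \<Longrightarrow> s \<le> 1 \<Longrightarrow> (\<integral>k. s ^ k \<partial>N) = PF_pgf \<theta> a b s"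
    using assms by (auto simp: PF_law_def)
  define s :: "nat \<Rightarrow> real" where "s n = 1 - 1 / real (Suc n)" for n
  have s: "0 \<le> s n" "s n < 1" for n by (auto simp: s_def)
  have s_lim: "s \<longlonglongrightarrow> 1"
    unfolding s_def[abs_def] using tendsto_diff[OF tendsto_const[of 1] LIMSEQ_inverse_real_of_nat]
    by (simp add: inverse_eq_divide)
  define g where "g n k = ennreal ((1 - s n ^ k) / (1 - s n))" for n k
  have "(\<integral>\<^sup>+k. of_nat k \<partial>N) = ennreal (a powr (- 1 / \<theta>))"
  proof (rule nn_integral_limit_from_below[where g = g])
    show "g n \<in> borel_measurable N" for n by measurable
    show "AE k in N. g n k \<le> of_nat k" for n
      using real_geometric_le[OF s] by (auto simp: g_def ennreal_of_nat_eq_real_of_nat intro!: ennreal_leI)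
    show "AE k in N. (\<lambda>n. g n k) \<longlonglongrightarrow> of_nat k"
      using tendsto_geometric_slope[OF s_lim s(2)]
      by (auto simp: g_def ennreal_of_nat_eq_real_of_nat intro!: tendsto_ennrealI)
    have "(\<integral>\<^sup>+k. g n k \<partial>N) = ennreal ((1 - PF_pgf \<theta> a b (1 - (1 - s n))) / (1 - s n))" for n
    proof -
      have int: "integrable N (\<lambda>k. s n ^ k)"
        using s[of n] by (intro integrable_const_bound[where B = 1]) (auto intro!: AE_I2 power_le_one)
      have "(\<integral>\<^sup>+k. g n k \<partial>N) = ennreal (\<integral>k. (1 - s n ^ k) / (1 - s n) \<partial>N)"
        unfolding g_def using s[of n] int
        by (intro nn_integral_eq_integral) (auto intro!: divide_nonneg_pos simp: power_le_one)
      also have "(\<integral>k. (1 - s n ^ k) / (1 - s n) \<partial>N) = (1 - PF_pgf \<theta> a b (s n)) / (1 - s n)"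
        using int s[of n] pgf[of "s n"] by (simp add: prob_space)
      finally show ?thesis by simp
    qed
    moreover have "(\<lambda>n. (1 - PF_pgf \<theta> a b (1 - (1 - s n))) / (1 - s n)) \<longlonglongrightarrow> a powr (- 1 / \<theta>)"
      using assms s tendsto_diff[OF tendsto_const[of 1] s_lim]
      by (intro tendsto_PF_pgf_slope) (auto simp: PF_law_def)
    ultimately show "(\<lambda>n. \<integral>\<^sup>+k. g n k \<partial>N) \<longlonglongrightarrow> ennreal (a powr (- 1 / \<theta>))"
      by (simp only: tendsto_ennrealI)
  qed
  then show ?thesis .
qed


section \<open>Supercritical environments\<close>

definition R_part :: "env \<Rightarrow> nat \<Rightarrow> real" where
  "R_part \<eta> n = (\<Sum>k<n. R_term \<eta> k)"

lemma Pi_env_0 [simp]: "Pi_env \<eta> 0 = 1"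
  by (simp add: Pi_env_def)

lemma Pi_env_Suc: "Pi_env \<eta> (Suc n) = Pi_env \<eta> n * envA \<eta> n"
  by (simp add: Pi_env_def)

lemma R_part_0 [simp]: "R_part \<eta> 0 = 0"
  by (simp add: R_part_def)

lemma R_part_Suc: "R_part \<eta> (Suc n) = R_part \<eta> n + Pi_env \<eta> n * envB \<eta> n"
  by (simp add: R_part_def R_term_def)

lemma Pi_env_shift: "envA \<eta> 0 * Pi_env (env_shift \<eta>) n = Pi_env \<eta> (Suc n)"
  unfolding Pi_env_def by (subst prod.lessThan_Suc_shift) (simp add: env_shift_def envA_def)

text \<open>One realisation outside the exceptional null set; everything proved here is
  deterministic.\<close>

locale supercritical_env =
  fixes \<eta> :: env
  assumes A_pos: "\<And>n. 0 < envA \<eta> n"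
    and B_pos: "\<And>n. 0 < envB \<eta> n"
    and AB_ge_1: "\<And>n. 1 \<le> envA \<eta> n + envB \<eta> n"
    and summable_R: "summable (R_term \<eta>)"
    and not_summable_Rdual: "\<not> summable (Rdual_term \<eta>)"
begin

lemma Pi_pos: "0 < Pi_env \<eta> n"
  by (simp add: Pi_env_def prod_pos A_pos)

lemma R_part_lim: "R_part \<eta> \<longlonglongrightarrow> R_inf \<eta>"
  unfolding R_part_def[abs_def] R_inf_def using summable_R by (rule summable_LIMSEQ)

text \<open>The sum is the image of x = 1, that is of s = 0, under the composed affine maps. Step
  \<open>n\<close> adds \<open>Pi_env \<eta> n\<close> times the nonnegative number A + B -
  1.\<close>

lemma incseq_Pi_R_part: "incseq (\<lambda>n. Pi_env \<eta> n + R_part \<eta> n)"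
proof (rule incseq_SucI)
  fix n
  have "Pi_env \<eta> n * 1 \<le> Pi_env \<eta> n * (envA \<eta> n + envB \<eta> n)"
    by (intro mult_left_mono AB_ge_1 less_imp_le Pi_pos)
  then show "Pi_env \<eta> n + R_part \<eta> n \<le> Pi_env \<eta> (Suc n) + R_part \<eta> (Suc n)"
    by (simp add: Pi_env_Suc R_part_Suc algebra_simps)
qed

lemma Rdual_term_eq: "Rdual_term \<eta> n = R_term \<eta> n * (inverse (Pi_env \<eta> n) * inverse (Pi_env \<eta> (Suc n)))"
  using Pi_pos[of n] by (simp add: Rdual_term_def R_term_def)

text \<open>If the products stayed away from \<open>0\<close>, the summands of the dual series would be bounded by
  a multiple of those of \<open>R\<^sub>\<infinity>\<close>.\<close>

lemma not_eventually_Pi_ge: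
  assumes "0 < c"
  shows "\<not> (\<forall>\<^sub>F n in sequentially. c \<le> Pi_env \<eta> n)"
proof
  assume "\<forall>\<^sub>F n in sequentially. c \<le> Pi_env \<eta> n"
  then obtain n0 where n0: "\<And>n. n \<ge> n0 \<Longrightarrow> c \<le> Pi_env \<eta> n"
    by (auto simp: eventually_sequentially)
  have "summable (Rdual_term \<eta>)"
  proof (rule summable_comparison_test')
    show "summable (\<lambda>n. R_term \<eta> n * (inverse c * inverse c))"
      using summable_R by (rule summable_mult2)
    show "norm (Rdual_term \<eta> n) \<le> R_term \<eta> n * (inverse c * inverse c)" if "n \<ge> n0" for n
    proof -
      have nn: "0 \<le> R_term \<eta> n" "0 \<le> Rdual_term \<eta> n"
        using Pi_pos[of n] Pi_pos[of "Suc n"] B_pos[of n]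
        by (auto simp: R_term_def Rdual_term_def intro!: mult_nonneg_nonneg)
      have "inverse (Pi_env \<eta> n) * inverse (Pi_env \<eta> (Suc n)) \<le> inverse c * inverse c"
        using assms n0[of n] n0[of "Suc n"] Pi_pos[of n] Pi_pos[of "Suc n"] that
        by (intro mult_mono le_imp_inverse_le) auto
      with nn show ?thesis
        by (simp add: Rdual_term_eq[symmetric] del: inverse_mult_distrib)
           (simp add: Rdual_term_eq mult_left_mono)
    qed
  qed
  with not_summable_Rdual show False by simp
qed

text \<open>\<open>?S\<close> is monotone, and it is bounded because a value above
  \<open>R_inf \<eta> + 1\<close> would persist and keep all later products above 1. Hence the
  products converge, as a difference of convergent sequences, and a positive limit would keep them
  above half of it, which \<open>not_eventually_Pi_ge\<close> excludes.\<close>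

lemma Pi_lim: "Pi_env \<eta> \<longlonglongrightarrow> 0"
proof -
  let ?S = "\<lambda>n. Pi_env \<eta> n + R_part \<eta> n"
  have not_ev: "\<not> (\<forall>\<^sub>F n in sequentially. c < Pi_env \<eta> n)" if "0 < c" for c
    using not_eventually_Pi_ge[OF that] by (meson eventually_mono less_imp_le)
  have R_le: "R_part \<eta> n \<le> R_inf \<eta>" for n
    unfolding R_part_def R_inf_def R_term_def using summable_R
    by (intro sum_le_suminf) (auto simp: R_term_def[abs_def] less_imp_le[OF Pi_pos] less_imp_le[OF B_pos])
  have bound: "?S n \<le> R_inf \<eta> + 1" for n
  proof (rule ccontr)
    assume "\<not> ?thesis"
    then have "1 < Pi_env \<eta> m" if "m \<ge> n" for m
      using incseqD[OF incseq_Pi_R_part that] R_le[of m] by simp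
    then have "\<forall>\<^sub>F m in sequentially. 1 < Pi_env \<eta> m"
      by (auto simp: eventually_sequentially)
    with not_ev[of 1] show False by simp
  qed
  obtain L where "?S \<longlonglongrightarrow> L"
    using incseq_convergent[OF incseq_Pi_R_part] bound by blast
  from tendsto_diff[OF this R_part_lim] have lim: "Pi_env \<eta> \<longlonglongrightarrow> L - R_inf \<eta>"
    by simp
  have "0 \<le> L - R_inf \<eta>"
    by (rule LIMSEQ_le_const[OF lim]) (auto intro!: exI[of _ 0] less_imp_le Pi_pos)
  moreover have "\<not> 0 < L - R_inf \<eta>"
    using order_tendstoD(1)[OF lim, of "(L - R_inf \<eta>) / 2"] not_ev[of "(L - R_inf \<eta>) / 2"]
    by (auto simp: field_simps)
  ultimately show ?thesis
    using lim by simp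
qed

lemma Pi_R_part_le: "Pi_env \<eta> n + R_part \<eta> n \<le> R_inf \<eta>"
  using incseq_le[OF incseq_Pi_R_part] tendsto_add[OF Pi_lim R_part_lim] by simp

lemma R_inf_ge_1: "1 \<le> R_inf \<eta>"
  using Pi_R_part_le[of 0] by simp

lemma R_inf_pos: "0 < R_inf \<eta>"
  using R_inf_ge_1 by simp

text \<open>The first summand is split off. Both recursions of the theorem are this identity read in
  other coordinates.\<close>

lemma R_inf_shift: "R_inf \<eta> = envA \<eta> 0 * R_inf (env_shift \<eta>) + envB \<eta> 0"
proof -
  have *: "R_term \<eta> (Suc n) = envA \<eta> 0 * R_term (env_shift \<eta>) n" for n
    by (simp add: R_term_def Pi_env_shift[symmetric]) (simp add: envB_def env_shift_def)
  have "summable (\<lambda>n. R_term \<eta> (Suc n))"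
    using summable_R by (simp add: summable_Suc_iff)
  then have s: "summable (R_term (env_shift \<eta>))"
    using A_pos[of 0] by (simp add: * summable_cmult_iff)
  have "R_inf \<eta> = (\<Sum>n. R_term \<eta> (Suc n)) + R_term \<eta> 0"
    unfolding R_inf_def using suminf_split_head[OF summable_R] by simp
  also have "(\<Sum>n. R_term \<eta> (Suc n)) = envA \<eta> 0 * R_inf (env_shift \<eta>)"
    unfolding * R_inf_def by (rule suminf_mult[OF s])
  finally show ?thesis by (simp add: R_term_def)
qed

end

section \<open>Convergence of bounded martingales\<close>

lemma (in finite_measure) bdd_integrable:
  fixes f :: "'a \<Rightarrow> real"
  assumes "f \<in> borel_measurable M" "\<And>x. x \<in> space M \<Longrightarrow> \<bar>f x\<bar> \<le> K"
  shows "integrable M f"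
  using assms by (intro integrable_const_bound[where B = K]) auto

text \<open>An event of \<open>F m\<close> belongs to every later \<open>F k\<close>, so its set
  integrals can be compared one step at a time; they characterise the conditional
  expectations.\<close>

lemma (in prob_space) is_martingale_one_stepI:
  assumes sub: "\<And>n. subalgebra M (F n)"
    and mono: "\<And>m n. m \<le> n \<Longrightarrow> sets (F m) \<subseteq> sets (F n)"
    and meas: "\<And>n. Y n \<in> borel_measurable (F n)"
    and int: "\<And>n. integrable M (Y n)"
    and step: "\<And>n A. A \<in> sets (F n) \<Longrightarrow>
      (\<integral>x. indicator A x * Y (Suc n) x \<partial>M) = (\<integral>x. indicator A x * Y n x \<partial>M)"
  shows "is_martingale M F Y"
proof -
  have eq: "(\<integral>x. indicator A x * Y n x \<partial>M) = (\<integral>x. indicator A x * Y m x \<partial>M)"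
    if "m \<le> n" "A \<in> sets (F m)" for m n A
    using that
  proof (induction n rule: dec_induct)
    case (step k)
    then show ?case
      using assms(5)[of A k] mono[of m k] by auto
  qed simp
  have "AE x in M. real_cond_exp M (F m) (Y n) x = Y m x" if "m \<le> n" for m n
  proof -
    interpret finite_measure_subalgebra M "F m"
      by unfold_locales (rule sub)
    show ?thesis
      using eq[OF that] int meas by (intro real_cond_exp_charact) (auto simp: set_lebesgue_integral_def)
  qed
  with assms show ?thesis
    by (simp add: is_martingale_def)
qed

text \<open>Kolmogorov's maximal inequality, applied to the increments after a late time, shows that
  almost every path is a Cauchy sequence.\<close>

lemma (in prob_space) bounded_martingale_convergent:
  assumes mart: "is_martingale M F Y"
    and bound: "\<And>n x. x \<in> space M \<Longrightarrow> \<bar>Y n x\<bar> \<le> C"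
  shows "AE x in M. convergent (\<lambda>n. Y n x)"
proof -
  have sub: "subalgebra M (F n)" and meas_F: "Y n \<in> borel_measurable (F n)" for n
    using mart by (auto simp: is_martingale_def)
  have mono: "sets (F m) \<subseteq> sets (F n)" if "m \<le> n" for m n
    using mart that by (auto simp: is_martingale_def)
  have space_F: "space (F n) = space M" for n
    using sub[of n] by (auto simp: subalgebra_def)
  have meas_F': "Y m \<in> borel_measurable (F n)" if "m \<le> n" for m n
    using meas_F[of m] mono[OF that] by (auto simp: measurable_def space_F)
  have [measurable]: "Y n \<in> borel_measurable M" for n
    by (rule measurable_from_subalg[OF sub meas_F])
  have C_nonneg: "0 \<le> C"
    using bound not_empty by (metis abs_ge_zero ex_in_conv order_trans)
  \<comment> \<open>Increments after time \<open>m\<close> are orthogonal to bounded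
    \<open>F m\<close>-measurable factors. The conditional expectations enter only here.\<close>
  have orth: "(\<integral>x. H x * Y n x \<partial>M) = (\<integral>x. H x * Y m x \<partial>M)"
    if "m \<le> n" "H \<in> borel_measurable (F m)" "\<And>x. x \<in> space M \<Longrightarrow> \<bar>H x\<bar> \<le> D" for H m n D
  proof -
    interpret finite_measure_subalgebra M "F m"
      by unfold_locales (rule sub)
    have [measurable]: "H \<in> borel_measurable M"
      by (rule measurable_from_subalg[OF sub that(2)])
    have "integrable M (\<lambda>x. H x * Y n x)"
      using that(3) bound by (intro bdd_integrable[where K = "D * C"]) (auto simp: abs_mult intro!: mult_mono order_trans[OF abs_ge_zero])
    then have "(\<integral>x. H x * Y n x \<partial>M) = (\<integral>x. H x * real_cond_exp M (F m) (Y n) x \<partial>M)"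
      using that(2) by (intro real_cond_exp_intg(2)[symmetric]) auto
    also have "\<dots> = (\<integral>x. H x * Y m x \<partial>M)"
    proof (rule integral_cong_AE)
      have "AE x in M. real_cond_exp M (F m) (Y n) x = Y m x"
        using mart that(1) by (simp add: is_martingale_def)
      then show "AE x in M. H x * real_cond_exp M (F m) (Y n) x = H x * Y m x"
        by eventually_elim simp
    qed measurable
    finally show ?thesis .
  qed
  have Y_sq: "\<bar>Y n x * Y m x\<bar> \<le> C * C" if "x \<in> space M" for n m x
    using bound[OF that] C_nonneg by (auto simp: abs_mult intro!: mult_mono)
  have int_Y [simp]: "integrable M (\<lambda>x. Y n x * Y m x)" for n m
    using Y_sq by (intro bdd_integrable[where K = "C * C"]) auto
  have diff_bound: "\<bar>Y k x - Y m x\<bar> \<le> 2 * C" if "x \<in> space M" for k m x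
    using bound[OF that, of k] bound[OF that, of m] by linarith
  have diff_sq: "(Y k x - Y m x)\<^sup>2 \<le> (2 * C)\<^sup>2" if "x \<in> space M" for k m x
    using power_mono[OF diff_bound[OF that], of k m 2] by simp
  \<comment> \<open>By orthogonality the second moments grow exactly by the mean squares of the
    increments; being bounded, they converge, and \<open>L - a m\<close> controls everything after
    time \<open>m\<close>.\<close>
  define a where "a n = (\<integral>x. Y n x * Y n x \<partial>M)" for n
  have a_diff: "(\<integral>x. (Y n x - Y m x)\<^sup>2 \<partial>M) = a n - a m" if "m \<le> n" for m n
  proof -
    have "(\<integral>x. Y m x * Y n x \<partial>M) = a m"
      unfolding a_def using bound by (intro orth[OF that meas_F]) auto
    then show ?thesis
      by (simp add: power2_eq_square algebra_simps a_def)
  qed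
  have incseq_a: "incseq a"
  proof (rule incseq_SucI)
    fix n
    have "0 \<le> (\<integral>x. (Y (Suc n) x - Y n x)\<^sup>2 \<partial>M)"
      by simp
    then show "a n \<le> a (Suc n)" by (simp add: a_diff)
  qed
  have a_le: "a n \<le> C * C" for n
  proof -
    have "a n \<le> (\<integral>x. C * C \<partial>M)"
      unfolding a_def using Y_sq by (intro integral_mono) (auto dest: abs_le_D1)
    then show ?thesis by (simp add: prob_space)
  qed
  obtain L where L: "a \<longlonglongrightarrow> L" "\<And>n. a n \<le> L"
    using incseq_convergent[OF incseq_a] a_le by blast

  define far where "far \<epsilon> m k = {x \<in> space M. \<epsilon> \<le> \<bar>Y k x - Y m x\<bar>}" for \<epsilon> m k
  have far_sets [measurable]: "far \<epsilon> m k \<in> sets M" for \<epsilon> m k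
    unfolding far_def by measurable
  have maximal: "\<epsilon>\<^sup>2 * prob (\<Union>k\<in>{m..n}. far \<epsilon> m k) \<le> a n - a m" if "0 < \<epsilon>" "m \<le> n" for \<epsilon> m n
  proof -
    \<comment> \<open>First-passage decomposition: \<open>k\<close> is the first time from
      \<open>m\<close> on at distance at least \<open>\<epsilon>\<close> from \<open>Y m\<close>.
      This makes the pieces disjoint and each one known at time \<open>k\<close>.\<close>
    define A where "A k = {x \<in> space M. \<epsilon> \<le> \<bar>Y k x - Y m x\<bar> \<and> (\<forall>j\<in>{m..<k}. \<bar>Y j x - Y m x\<bar> < \<epsilon>)}" for k
    have A_F: "A k \<in> sets (F k)" if "m \<le> k" for k
    proof -
      have *: "(\<lambda>x. \<bar>Y j x - Y m x\<bar>) \<in> borel_measurable (F k)" if "j \<le> k" for j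
        using that \<open>m \<le> k\<close> by (intro borel_measurable_abs borel_measurable_diff meas_F')
      have "{x \<in> space (F k). \<epsilon> \<le> \<bar>Y k x - Y m x\<bar> \<and> (\<forall>j\<in>{m..<k}. \<bar>Y j x - Y m x\<bar> < \<epsilon>)} \<in> sets (F k)"
        by (intro sets.sets_Collect_conj sets.sets_Collect_finite_All borel_measurable_le
              borel_measurable_less borel_measurable_const *) auto
      then show ?thesis by (simp add: A_def space_F)
    qed
    have A_sets: "A k \<in> sets M" if "m \<le> k" for k
      using A_F[OF that] sub[of k] by (auto simp: subalgebra_def)
    have disj: "disjoint_family_on A {m..n}"
    proof -
      have *: "x \<notin> A l" if "m \<le> k" "k < l" "x \<in> A k" for x k l
        using that by (auto simp: A_def not_less intro!: bexI[of _ k])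
      show ?thesis
        unfolding disjoint_family_on_def
      proof (intro ballI impI)
        fix k l assume "k \<in> {m..n}" "l \<in> {m..n}" "k \<noteq> l"
        then show "A k \<inter> A l = {}"
          using *[of k l] *[of l k] by (cases "k < l") (auto simp: disjoint_iff)
      qed
    qed
    have cover: "(\<Union>k\<in>{m..n}. far \<epsilon> m k) \<subseteq> (\<Union>k\<in>{m..n}. A k)"
    proof
      fix x assume "x \<in> (\<Union>k\<in>{m..n}. far \<epsilon> m k)"
      then obtain k where k: "m \<le> k" "k \<le> n" "x \<in> space M" "\<epsilon> \<le> \<bar>Y k x - Y m x\<bar>"
        by (auto simp: far_def)
      obtain l where l: "m \<le> l" "\<epsilon> \<le> \<bar>Y l x - Y m x\<bar>" "l \<le> k"
        and least: "\<And>j. j < l \<Longrightarrow> \<not> (m \<le> j \<and> \<epsilon> \<le> \<bar>Y j x - Y m x\<bar>)"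
        using k exists_least_iff[of "\<lambda>l. m \<le> l \<and> \<epsilon> \<le> \<bar>Y l x - Y m x\<bar>"]
        by (metis not_le_imp_less)
      have "\<forall>j\<in>{m..<l}. \<bar>Y j x - Y m x\<bar> < \<epsilon>"
        using least by (meson atLeastLessThan_iff not_le_imp_less)
      then show "x \<in> (\<Union>k\<in>{m..n}. A k)"
        using l k by (auto simp: A_def)
    qed
    have int_A: "integrable M (\<lambda>x. indicator (A k) x * (Y j x - Y m x)\<^sup>2)" if "m \<le> k" for j k
      using diff_sq A_sets[OF that]
      by (intro bdd_integrable[where K = "(2 * C)\<^sup>2"]) (auto simp: indicator_def)
    have piece: "\<epsilon>\<^sup>2 * prob (A k) \<le> (\<integral>x. indicator (A k) x * (Y n x - Y m x)\<^sup>2 \<partial>M)" if k: "k \<in> {m..n}" for k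
    proof -
      have [measurable]: "A k \<in> sets M" using k by (intro A_sets) auto
      \<comment> \<open>Bounded and known at time \<open>k\<close>, so its product with the
        increment from \<open>k\<close> to \<open>n\<close> has integral zero.\<close>
      define H where "H x = indicator (A k) x * (Y k x - Y m x)" for x
      have H_meas: "H \<in> borel_measurable (F k)"
        unfolding H_def[abs_def] using k A_F[of k]
        by (intro borel_measurable_times borel_measurable_diff borel_measurable_indicator meas_F') auto
      have [measurable]: "H \<in> borel_measurable M"
        by (rule measurable_from_subalg[OF sub H_meas])
      have H_bound: "\<bar>H x\<bar> \<le> 2 * C" if "x \<in> space M" for x
        using diff_bound[OF that] C_nonneg by (auto simp: H_def indicator_def)
      have HY: "integrable M (\<lambda>x. H x * Y j x)" for j
        using H_bound bound C_nonneg
        by (intro bdd_integrable[where K = "2 * C * C"]) (auto simp: abs_mult intro!: mult_mono)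
      have H0: "(\<integral>x. H x * Y n x \<partial>M) = (\<integral>x. H x * Y k x \<partial>M)"
        using k H_bound by (intro orth H_meas) auto
      have int_ind: "integrable M (indicator (A k) :: _ \<Rightarrow> real)"
        by (intro bdd_integrable[where K = 1]) (auto simp: indicator_def)
      have "\<epsilon>\<^sup>2 * prob (A k) = (\<integral>x. \<epsilon>\<^sup>2 * indicator (A k) x \<partial>M)"
        by simp
      also have "\<dots> \<le> (\<integral>x. indicator (A k) x * (Y k x - Y m x)\<^sup>2 \<partial>M)"
      proof (rule integral_mono)
        show "\<epsilon>\<^sup>2 * indicator (A k) x \<le> indicator (A k) x * (Y k x - Y m x)\<^sup>2" if "x \<in> space M" for x
          using \<open>0 < \<epsilon>\<close> power_mono[of \<epsilon> "\<bar>Y k x - Y m x\<bar>" 2] by (auto simp: A_def indicator_def)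
      qed (use k int_A int_ind in auto)
      \<comment> \<open>Adding twice the vanishing cross term completes the square: on
        \<open>A k\<close> only the square of \<open>Y n x - Y k x\<close> is then missing, so the
        next inequality holds pointwise.\<close>
      also have "\<dots> = (\<integral>x. indicator (A k) x * (Y k x - Y m x)\<^sup>2 + 2 * (H x * Y n x - H x * Y k x) \<partial>M)"
        using k int_A HY H0 by simp
      also have "\<dots> \<le> (\<integral>x. indicator (A k) x * (Y n x - Y m x)\<^sup>2 \<partial>M)"
      proof (rule integral_mono)
        show "indicator (A k) x * (Y k x - Y m x)\<^sup>2 + 2 * (H x * Y n x - H x * Y k x)
            \<le> indicator (A k) x * (Y n x - Y m x)\<^sup>2" for x
          using zero_le_power2[of "Y n x - Y k x"]
          by (auto simp: H_def indicator_def power2_eq_square algebra_simps)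
      qed (use k int_A HY in auto)
      finally show ?thesis .
    qed
    have "\<epsilon>\<^sup>2 * prob (\<Union>k\<in>{m..n}. far \<epsilon> m k) \<le> \<epsilon>\<^sup>2 * prob (\<Union>k\<in>{m..n}. A k)"
      using cover A_sets by (intro mult_left_mono finite_measure_mono) auto
    also have "prob (\<Union>k\<in>{m..n}. A k) = (\<Sum>k\<in>{m..n}. prob (A k))"
      using disj A_sets by (intro finite_measure_finite_Union) auto
    also have "\<epsilon>\<^sup>2 * (\<Sum>k\<in>{m..n}. prob (A k)) \<le> (\<Sum>k\<in>{m..n}. \<integral>x. indicator (A k) x * (Y n x - Y m x)\<^sup>2 \<partial>M)"
      unfolding sum_distrib_left by (rule sum_mono[OF piece])
    also have "\<dots> = (\<integral>x. (\<Sum>k\<in>{m..n}. indicator (A k) x * (Y n x - Y m x)\<^sup>2) \<partial>M)"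
      by (intro Bochner_Integration.integral_sum[symmetric] int_A) auto
    also have "\<dots> \<le> (\<integral>x. (Y n x - Y m x)\<^sup>2 \<partial>M)"
    proof (rule integral_mono)
      have "(\<Sum>k\<in>{m..n}. indicator (A k) x) = (indicator (\<Union>k\<in>{m..n}. A k) x :: real)" for x
        using disj by (subst indicator_UN_disjoint) auto
      then show "(\<Sum>k\<in>{m..n}. indicator (A k) x * (Y n x - Y m x)\<^sup>2) \<le> (Y n x - Y m x)\<^sup>2" for x
        unfolding sum_distrib_right[symmetric] by (simp add: indicator_def)
      show "integrable M (\<lambda>x. (Y n x - Y m x)\<^sup>2)"
        using diff_sq by (intro bdd_integrable[where K = "(2 * C)\<^sup>2"]) auto
      show "integrable M (\<lambda>x. \<Sum>k\<in>{m..n}. indicator (A k) x * (Y n x - Y m x)\<^sup>2)"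
        by (intro Bochner_Integration.integrable_sum int_A) auto
    qed
    also have "\<dots> = a n - a m"
      by (rule a_diff[OF \<open>m \<le> n\<close>])
    finally show ?thesis .
  qed
  have tail: "\<epsilon>\<^sup>2 * prob (\<Union>k\<in>{m..}. far \<epsilon> m k) \<le> L - a m" if "0 < \<epsilon>" for \<epsilon> m
  proof -
    have "(\<lambda>n. prob (\<Union>k\<in>{m..n}. far \<epsilon> m k)) \<longlonglongrightarrow> prob (\<Union>n. \<Union>k\<in>{m..n}. far \<epsilon> m k)"
    proof (rule finite_Lim_measure_incseq)
      show "incseq (\<lambda>n. \<Union>k\<in>{m..n}. far \<epsilon> m k)"
        unfolding incseq_def by (intro allI impI UN_mono) auto
    qed auto
    also have "(\<Union>n. \<Union>k\<in>{m..n}. far \<epsilon> m k) = (\<Union>k\<in>{m..}. far \<epsilon> m k)"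
      by force
    finally have lim: "(\<lambda>n. \<epsilon>\<^sup>2 * prob (\<Union>k\<in>{m..n}. far \<epsilon> m k)) \<longlonglongrightarrow> \<epsilon>\<^sup>2 * prob (\<Union>k\<in>{m..}. far \<epsilon> m k)"
      by (intro tendsto_intros)
    have "\<forall>n\<ge>m. \<epsilon>\<^sup>2 * prob (\<Union>k\<in>{m..n}. far \<epsilon> m k) \<le> L - a m"
    proof (intro allI impI)
      fix n assume "m \<le> n"
      from maximal[OF that this] L(2)[of n]
      show "\<epsilon>\<^sup>2 * prob (\<Union>k\<in>{m..n}. far \<epsilon> m k) \<le> L - a m" by linarith
    qed
    then show ?thesis
      by (intro LIMSEQ_le_const2[OF lim] exI)
  qed
  have "AE x in M. \<exists>m. \<forall>k\<ge>m. \<bar>Y k x - Y m x\<bar> < \<epsilon>" if "0 < \<epsilon>" for \<epsilon>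
  proof -
    \<comment> \<open>The paths for which no starting time \<open>m\<close> works. Their probability
      lies below every tail bound, and \<open>L - a m\<close> tends to 0.\<close>
    define B where "B = (\<Inter>m. \<Union>k\<in>{m..}. far \<epsilon> m k)"
    have [measurable]: "B \<in> sets M" unfolding B_def by measurable
    have "\<epsilon>\<^sup>2 * prob B \<le> L - a m" for m
    proof -
      have "\<epsilon>\<^sup>2 * prob B \<le> \<epsilon>\<^sup>2 * prob (\<Union>k\<in>{m..}. far \<epsilon> m k)"
        unfolding B_def by (intro mult_left_mono finite_measure_mono) auto
      with tail[OF that, of m] show ?thesis by simp
    qed
    then have "\<epsilon>\<^sup>2 * prob B \<le> L - L"
      using L(1) by (intro LIMSEQ_le_const[OF tendsto_diff[OF tendsto_const]]) auto
    with that have "prob B = 0"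
      by (simp add: mult_le_0_iff measure_le_0_iff)
    then have "AE x in M. x \<notin> B"
      by (simp add: prob_eq_0)
    then show ?thesis
      by (rule AE_mp) (auto intro!: AE_I2 simp: B_def far_def not_le)
  qed
  then have "AE x in M. \<forall>i. \<exists>m. \<forall>k\<ge>m. \<bar>Y k x - Y m x\<bar> < inverse (real (Suc i))"
    by (subst AE_all_countable) auto
  then show ?thesis
  proof (rule AE_mp, intro AE_I2 impI)
    fix x assume x: "\<forall>i. \<exists>m. \<forall>k\<ge>m. \<bar>Y k x - Y m x\<bar> < inverse (real (Suc i))"
    have "Cauchy (\<lambda>n. Y n x)"
    proof (rule metric_CauchyI)
      fix e :: real assume "0 < e"
      then obtain i where i: "inverse (real (Suc i)) < e / 2"
        using reals_Archimedean[of "e / 2"] by auto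
      obtain m where m: "\<And>k. k \<ge> m \<Longrightarrow> \<bar>Y k x - Y m x\<bar> < inverse (real (Suc i))"
        using x by blast
      have "dist (Y k x) (Y l x) < e" if "k \<ge> m" "l \<ge> m" for k l
        using m[OF that(1)] m[OF that(2)] i by (simp add: dist_real_def abs_real_def split: if_splits)
      then show "\<exists>m. \<forall>k\<ge>m. \<forall>l\<ge>m. dist (Y k x) (Y l x) < e" by blast
    qed
    then show "convergent (\<lambda>n. Y n x)"
      by (simp add: Cauchy_convergent_iff)
  qed
qed

section \<open>The branching process in a fixed environment\<close>

lemma GW_cong:
  assumes "\<And>j k. j < n \<Longrightarrow> X j k \<omega> = Y j k \<omega>'"
  shows "GW X n \<omega> = GW Y n \<omega>'"
  using assms by (induction n) auto

text \<open>The number of summands is random; it is frozen at each of its countably many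
  values.\<close>

lemma measurable_GW:
  assumes "\<And>j k. j < n \<Longrightarrow> X j k \<in> measurable M (count_space UNIV)"
  shows "GW X n \<in> measurable M (count_space UNIV)"
  using assms
proof (induction n)
  case (Suc n)
  have "(\<lambda>\<omega>. \<Sum>k<GW X n \<omega>. X n k \<omega>) \<in> measurable M (count_space UNIV)"
  proof (rule measurable_compose_countable[where g = "GW X n"])
    show "GW X n \<in> measurable M (count_space UNIV)"
      using Suc by simp
    show "(\<lambda>\<omega>. \<Sum>k<z. X n k \<omega>) \<in> measurable M (count_space UNIV)" for z
      using Suc.prems by (intro measurable_sum_nat) simp
  qed
  moreover have "GW X (Suc n) = (\<lambda>\<omega>. \<Sum>k<GW X n \<omega>. X n k \<omega>)"
    by (simp add: fun_eq_iff)
  ultimately show ?case by simp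
next
  case 0
  have "GW X 0 = (\<lambda>_. 1)"
    by (simp add: fun_eq_iff)
  then show ?case by simp
qed

lemma measurable_env_of:
  assumes "\<And>n. e n \<in> measurable M borel"
  shows "env_of e \<in> measurable M env_space"
  using assms by (intro measurable_PiM_single') auto

lemma measurable_envA [measurable]: "(\<lambda>\<eta>. envA \<eta> n) \<in> borel_measurable env_space"
  unfolding envA_def
  by (rule measurable_compose[where g = fst, OF measurable_component_singleton])
     (auto intro!: borel_measurable_continuous_onI continuous_intros)

lemma measurable_envB [measurable]: "(\<lambda>\<eta>. envB \<eta> n) \<in> borel_measurable env_space"
  unfolding envB_def
  by (rule measurable_compose[where g = snd, OF measurable_component_singleton])
     (auto intro!: borel_measurable_continuous_onI continuous_intros)

lemma measurable_Pi_env [measurable]: "(\<lambda>\<eta>. Pi_env \<eta> n) \<in> borel_measurable env_space"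
  unfolding Pi_env_def by measurable

lemma measurable_history:
  assumes "\<And>n. e n \<in> measurable M borel" "\<And>n k. X n k \<in> measurable M (count_space UNIV)"
  shows "(\<lambda>\<omega>. (env_of e \<omega>, \<lambda>k\<in>{..n}. GW X k \<omega>)) \<in> measurable M (env_space \<Otimes>\<^sub>M PiM {..n} (\<lambda>_. count_space UNIV))"
  using assms by (intro measurable_Pair measurable_env_of measurable_restrict measurable_GW)

lemma history_range:
  "(\<lambda>\<omega>. (env_of e \<omega>, \<lambda>k\<in>{..n}. GW X k \<omega>)) \<in> S \<rightarrow> space (env_space \<Otimes>\<^sub>M PiM {..n} (\<lambda>_. count_space UNIV))"
  by (auto simp: space_pair_measure space_PiM)

lemma measurable_history_GW_filtration:
  "(\<lambda>\<omega>. (env_of e \<omega>, \<lambda>k\<in>{..n}. GW X k \<omega>)) \<in>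
    measurable (GW_filtration M e X n) (env_space \<Otimes>\<^sub>M PiM {..n} (\<lambda>_. count_space UNIV))"
  unfolding GW_filtration_def by (rule measurable_vimage_algebra1[OF history_range])

lemma space_GW_filtration [simp]: "space (GW_filtration M e X n) = space M"
  by (simp add: GW_filtration_def)

lemma subalgebra_GW_filtration:
  assumes "\<And>n. e n \<in> measurable M borel" "\<And>n k. X n k \<in> measurable M (count_space UNIV)"
  shows "subalgebra M (GW_filtration M e X n)"
  unfolding subalgebra_def
proof
  show "sets (GW_filtration M e X n) \<subseteq> sets M"
    unfolding GW_filtration_def by (rule sets_image_in_sets) (auto intro: measurable_history assms)
qed simp

lemma GW_filtration_mono:
  assumes "m \<le> n"
  shows "sets (GW_filtration M e X m) \<subseteq> sets (GW_filtration M e X n)"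
proof -
  define \<pi> where "\<pi> = (\<lambda>(\<eta> :: env, z :: nat \<Rightarrow> nat). (\<eta>, restrict z {..m}))"
  have "\<pi> \<in> measurable (env_space \<Otimes>\<^sub>M PiM {..n} (\<lambda>_. count_space UNIV)) (env_space \<Otimes>\<^sub>M PiM {..m} (\<lambda>_. count_space UNIV))"
    unfolding \<pi>_def using assms
    by (auto simp: split_beta' intro!: measurable_Pair measurable_restrict
        measurable_compose[OF measurable_snd measurable_component_singleton])
  from measurable_compose[OF measurable_history_GW_filtration[where e = e and X = X and n = n and M = M] this]
  have "(\<lambda>\<omega>. (env_of e \<omega>, \<lambda>k\<in>{..m}. GW X k \<omega>)) \<in>
      measurable (GW_filtration M e X n) (env_space \<Otimes>\<^sub>M PiM {..m} (\<lambda>_. count_space UNIV))"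
    using assms by (simp add: \<pi>_def Int_absorb1)
  then show ?thesis
    unfolding GW_filtration_def[of M e X m] by (intro sets_image_in_sets) auto
qed

lemma measurable_GW_filtration_GW:
  "GW X n \<in> measurable (GW_filtration M e X n) (count_space UNIV)"
proof -
  have "(\<lambda>p. snd p n) \<in> measurable (env_space \<Otimes>\<^sub>M PiM {..n} (\<lambda>_. count_space UNIV)) (count_space (UNIV :: nat set))"
    by (auto intro!: measurable_compose[OF measurable_snd measurable_component_singleton])
  from measurable_compose[OF measurable_history_GW_filtration[where e = e and X = X and n = n and M = M] this]
  show ?thesis by simp
qed

lemma measurable_GW_filtration_W_proc:
  "W_proc \<theta> e X n \<in> borel_measurable (GW_filtration M e X n)"
proof -
  have "(\<lambda>\<omega>. Pi_env (env_of e \<omega>) n) \<in> borel_measurable (GW_filtration M e X n)"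
    using measurable_compose[OF measurable_compose[OF measurable_history_GW_filtration[where e = e and X = X and n = n and M = M] measurable_fst] measurable_Pi_env]
    by simp
  moreover note [measurable] = measurable_GW_filtration_GW[where e = e and X = X and n = n and M = M]
  ultimately show ?thesis
    unfolding W_proc_def[abs_def] by measurable
qed

lemma W_proc_nonneg: "0 \<le> W_proc \<theta> e X n \<omega>"
  by (simp add: W_proc_def)

text \<open>For nonnegative processes the one-step identity may be checked with extended integrals,
  where Fubini and products require no integrability.\<close>

lemma (in prob_space) is_martingale_nn_stepI:
  assumes sub: "\<And>n. subalgebra M (F n)"
    and mono: "\<And>m n. m \<le> n \<Longrightarrow> sets (F m) \<subseteq> sets (F n)"
    and meas: "\<And>n. Y n \<in> borel_measurable (F n)"
    and int: "\<And>n. integrable M (Y n)"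
    and nonneg: "\<And>n x. 0 \<le> Y n x"
    and step: "\<And>n A. A \<in> sets (F n) \<Longrightarrow>
      (\<integral>\<^sup>+x. indicator A x * ennreal (Y (Suc n) x) \<partial>M) = (\<integral>\<^sup>+x. indicator A x * ennreal (Y n x) \<partial>M)"
  shows "is_martingale M F Y"
proof (rule is_martingale_one_stepI[OF sub mono meas int])
  fix n A assume A: "A \<in> sets (F n)"
  with sub[of n] have [measurable]: "A \<in> sets M" by (auto simp: subalgebra_def)
  have [measurable]: "Y n \<in> borel_measurable M" for n
    by (rule measurable_from_subalg[OF sub meas])
  have "(\<integral>x. indicator A x * Y m x \<partial>M) = enn2real (\<integral>\<^sup>+x. indicator A x * ennreal (Y m x) \<partial>M)" for m
    using nonneg by (subst integral_eq_nn_integral) (auto simp: ennreal_mult' ennreal_indicator[symmetric])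
  then show "(\<integral>x. indicator A x * Y (Suc n) x \<partial>M) = (\<integral>x. indicator A x * Y n x \<partial>M)"
    by (simp add: step[OF A])
qed auto

text \<open>\<open>N\<close> stands for the quenched measure at the fixed environment
  \<open>\<eta>\<close>. \<open>M\<close> supplies only the measurable structure: the filtration is
  built from \<open>M\<close> and \<open>e\<close>, so \<open>e\<close> remains a random element,
  linked to \<open>\<eta>\<close> by \<open>AE_env\<close>.\<close>

locale quenched_GW = prob_space N + supercritical_env \<eta>
  for N :: "'a measure" and \<eta> :: env +
  fixes M :: "'a measure" and e :: "nat \<Rightarrow> 'a \<Rightarrow> real \<times> real" and X :: "nat \<Rightarrow> nat \<Rightarrow> 'a \<Rightarrow> nat" and \<theta> :: real
  assumes sets_N: "sets N = sets M"
    and e_meas_M: "\<And>n. e n \<in> measurable M borel"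
    and AE_env: "AE \<omega> in N. env_of e \<omega> = \<eta>"
    and X_meas_M: "\<And>n k. X n k \<in> measurable M (count_space UNIV)"
    and offspring: "PF_offspring \<theta> \<eta> N X"
begin

lemma space_N: "space N = space M"
  by (rule sets_eq_imp_space_eq[OF sets_N])

lemma X_meas [measurable]: "X n k \<in> measurable N (count_space UNIV)"
  using X_meas_M by (simp add: measurable_cong_sets[OF sets_N refl])

lemma e_meas [measurable]: "e n \<in> measurable N borel"
  using e_meas_M by (simp add: measurable_cong_sets[OF sets_N refl])

lemma GW_meas [measurable]: "GW X n \<in> measurable N (count_space UNIV)"
  by (intro measurable_GW X_meas)

lemma filtration_subalgebra: "subalgebra N (GW_filtration M e X n)"
  using subalgebra_GW_filtration[OF e_meas_M X_meas_M, where n = n]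
  by (simp add: subalgebra_def sets_N space_N)

lemma W_proc_meas [measurable]: "W_proc \<theta> e X n \<in> borel_measurable N"
  by (rule measurable_from_subalg[OF filtration_subalgebra measurable_GW_filtration_W_proc])

lemma law_X: "PF_law \<theta> (envA \<eta> n) (envB \<eta> n) (distr N (count_space UNIV) (X n k))"
  using offspring by (simp add: PF_offspring_def)

lemma theta_pos: "0 < \<theta>" and theta_le_1: "\<theta> \<le> 1"
  using law_X[of 0 0] by (simp_all add: PF_law_def)

lemma indep_X: "indep_vars (\<lambda>_. count_space UNIV) (\<lambda>(n, k). X n k) UNIV"
  using offspring by (simp add: PF_offspring_def)

lemma X_mean: "(\<integral>\<^sup>+\<omega>. of_nat (X n k \<omega>) \<partial>N) = ennreal (envA \<eta> n powr (- 1 / \<theta>))"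
  using PF_law_mean[OF law_X[of n k]] by (subst (asm) nn_integral_distr) auto

abbreviation f :: "nat \<Rightarrow> real \<Rightarrow> real" where
  "f n \<equiv> PF_pgf \<theta> (envA \<eta> n) (envB \<eta> n)"

text \<open>The bounds are read off the integral and not off the formula; they make
  \<open>f n s\<close> admissible as the next argument.\<close>

lemma X_pgf:
  assumes "0 \<le> s" "s \<le> 1"
  shows "(\<integral>\<^sup>+\<omega>. ennreal (s ^ X n k \<omega>) \<partial>N) = ennreal (f n s)"
    and "0 \<le> f n s" and "f n s \<le> 1"
proof -
  have int: "integrable N (\<lambda>\<omega>. s ^ X n k \<omega>)"
    using assms by (intro bdd_integrable[where K = 1]) (auto simp: power_le_one)
  have f: "(\<integral>\<omega>. s ^ X n k \<omega> \<partial>N) = f n s"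
    using law_X[of n k] assms by (auto simp: PF_law_def integral_distr)
  show "(\<integral>\<^sup>+\<omega>. ennreal (s ^ X n k \<omega>) \<partial>N) = ennreal (f n s)"
    using int assms f by (subst nn_integral_eq_integral) auto
  show "0 \<le> f n s"
    unfolding f[symmetric] using assms by (intro integral_nonneg_AE) auto
  have "(\<integral>\<omega>. s ^ X n k \<omega> \<partial>N) \<le> (\<integral>\<omega>. 1 \<partial>N)"
    using assms int by (intro integral_mono) (auto simp: power_le_one)
  then show "f n s \<le> 1"
    by (simp add: f prob_space)
qed

section \<open>Independence of a generation from the past\<close>

abbreviation past_space :: "nat \<Rightarrow> (nat \<times> nat \<Rightarrow> nat) measure" where
  "past_space n \<equiv> PiM ({..<n} \<times> UNIV) (\<lambda>_. count_space UNIV)"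

text \<open>All offspring numbers before generation \<open>n\<close> as one point of a product
  space. The process up to generation \<open>n\<close> is a function of this point, recomputed by
  \<open>GW\<close> on coordinates, and independence becomes a product law.\<close>

definition past :: "nat \<Rightarrow> 'a \<Rightarrow> nat \<times> nat \<Rightarrow> nat" where
  "past n \<omega> = (\<lambda>i\<in>{..<n} \<times> UNIV. (case i of (j, k) \<Rightarrow> X j k) \<omega>)"

lemma past_meas [measurable]: "past n \<in> measurable N (past_space n)"
  unfolding past_def[abs_def] by (intro measurable_restrict) (auto split: prod.split)

lemma measurable_past_GW:
  assumes "m \<le> n"
  shows "GW (\<lambda>j k u. u (j, k)) m \<in> measurable (past_space n) (count_space UNIV)"
  using assms by (intro measurable_GW measurable_component_singleton) auto

lemma past_GW:
  assumes "m \<le> n"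
  shows "GW (\<lambda>j k u. u (j, k)) m (past n \<omega>) = GW X m \<omega>"
  using assms by (intro GW_cong) (auto simp: past_def)

text \<open>Events of the filtration also involve the environment. Under \<open>N\<close> it is
  almost surely \<open>\<eta>\<close>, and substituting this constant leaves a function of past
  offspring numbers alone, to which independence applies.\<close>

lemma filtration_indicator:
  assumes "A \<in> sets (GW_filtration M e X n)"
  obtains H :: "_ \<Rightarrow> ennreal" where "H \<in> borel_measurable (past_space n)"
    "AE \<omega> in N. indicator A \<omega> = H (past n \<omega>)"
proof -
  let ?h = "\<lambda>\<omega>. (env_of e \<omega>, \<lambda>k\<in>{..n}. GW X k \<omega>)"
  obtain B where B: "B \<in> sets (env_space \<Otimes>\<^sub>M PiM {..n} (\<lambda>_. count_space UNIV))" "A = ?h -` B \<inter> space M"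
    using assms unfolding GW_filtration_def sets_vimage_algebra2[OF history_range] by auto
  define H where "H u = (indicator B (\<eta>, \<lambda>k\<in>{..n}. GW (\<lambda>j k u. u (j, k)) k u) :: ennreal)" for u
  have "(\<lambda>u. (\<eta>, \<lambda>k\<in>{..n}. GW (\<lambda>j k u. u (j, k)) k u)) \<in>
      measurable (past_space n) (env_space \<Otimes>\<^sub>M PiM {..n} (\<lambda>_. count_space UNIV))"
    by (intro measurable_Pair measurable_const measurable_restrict measurable_past_GW) (auto simp: space_PiM)
  from measurable_compose[OF this borel_measurable_indicator[OF B(1)]]
  have "H \<in> borel_measurable (past_space n)"
    by (simp add: H_def[abs_def])
  moreover have "AE \<omega> in N. indicator A \<omega> = H (past n \<omega>)"
    using AE_env
  proof (rule AE_mp, intro AE_I2 impI)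
    fix \<omega> assume "\<omega> \<in> space N" "env_of e \<omega> = \<eta>"
    moreover have "(\<lambda>k\<in>{..n}. GW (\<lambda>j k u. u (j, k)) k (past n \<omega>)) = (\<lambda>k\<in>{..n}. GW X k \<omega>)"
      by (intro restrict_ext past_GW) auto
    ultimately show "indicator A \<omega> = H (past n \<omega>)"
      by (auto simp: H_def B(2) space_N indicator_def)
  qed
  ultimately show ?thesis by (rule that)
qed

text \<open>Fubini for the past and generation \<open>n\<close>: with the past fixed,
  \<open>GW X n\<close> is a number \<open>z\<close>, and \<open>K z\<close> is the remaining
  integral. A general \<open>\<phi>\<close> covers both powers, for generating functions, and the
  identity, for means.\<close>

lemma GW_branching:
  fixes \<phi> :: "nat \<Rightarrow> ennreal"
  assumes "A \<in> sets (GW_filtration M e X n)"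
    and K: "\<And>z. (\<integral>\<^sup>+\<omega>. \<phi> (\<Sum>k<z. X n k \<omega>) \<partial>N) = K z"
  shows "(\<integral>\<^sup>+\<omega>. indicator A \<omega> * \<phi> (GW X (Suc n) \<omega>) \<partial>N) = (\<integral>\<^sup>+\<omega>. indicator A \<omega> * K (GW X n \<omega>) \<partial>N)"
proof -
  obtain H :: "_ \<Rightarrow> ennreal" where H [measurable]: "H \<in> borel_measurable (past_space n)"
    and A: "AE \<omega> in N. indicator A \<omega> = H (past n \<omega>)"
    using filtration_indicator[OF assms(1)] by blast
  let ?T = "PiM ({n} \<times> UNIV) (\<lambda>_. count_space UNIV) :: (nat \<times> nat \<Rightarrow> nat) measure"
  let ?Z = "GW (\<lambda>j k u. u (j, k)) n"
  define V where "V \<omega> = (\<lambda>i\<in>{n} \<times> UNIV. (case i of (j, k) \<Rightarrow> X j k) \<omega>)" for \<omega>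
  have V_meas [measurable]: "V \<in> measurable N ?T"
    unfolding V_def[abs_def] by (intro measurable_restrict) (auto split: prod.split)
  note [measurable] = measurable_past_GW[of n n, simplified]
  have "indep_var (past_space n) (past n) ?T V"
    unfolding past_def[abs_def] V_def[abs_def]
    by (rule indep_var_restrict[OF indep_X]) auto
  then have prod: "distr N (past_space n) (past n) \<Otimes>\<^sub>M distr N ?T V
      = distr N (past_space n \<Otimes>\<^sub>M ?T) (\<lambda>\<omega>. (past n \<omega>, V \<omega>))"
    by (simp add: indep_var_distribution_eq)
  interpret V: prob_space "distr N ?T V"
    by (rule prob_space_distr) measurable
  define F where "F p = H (fst p) * \<phi> (\<Sum>k<?Z (fst p). snd p (n, k))" for p
  have "(\<lambda>p. \<Sum>k<?Z (fst p). snd p (n, k)) \<in> measurable (past_space n \<Otimes>\<^sub>M ?T) (count_space UNIV)"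
  proof (rule measurable_compose_countable[where g = "\<lambda>p. ?Z (fst p)"])
    show "(\<lambda>p. ?Z (fst p)) \<in> measurable (past_space n \<Otimes>\<^sub>M ?T) (count_space UNIV)"
      by measurable
    show "(\<lambda>p. \<Sum>k<z. snd p (n, k)) \<in> measurable (past_space n \<Otimes>\<^sub>M ?T) (count_space UNIV)" for z
      by (intro measurable_sum_nat measurable_compose[OF measurable_snd measurable_component_singleton]) auto
  qed
  from measurable_compose[OF this, of \<phi> borel]
  have F [measurable]: "F \<in> borel_measurable (past_space n \<Otimes>\<^sub>M ?T)"
    unfolding F_def[abs_def] by measurable
  have "(\<integral>\<^sup>+\<omega>. indicator A \<omega> * \<phi> (GW X (Suc n) \<omega>) \<partial>N) = (\<integral>\<^sup>+\<omega>. F (past n \<omega>, V \<omega>) \<partial>N)"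
  proof (rule nn_integral_cong_AE)
    show "AE \<omega> in N. indicator A \<omega> * \<phi> (GW X (Suc n) \<omega>) = F (past n \<omega>, V \<omega>)"
      using A by eventually_elim (simp add: F_def past_GW V_def)
  qed
  also have "\<dots> = (\<integral>\<^sup>+p. F p \<partial>distr N (past_space n \<Otimes>\<^sub>M ?T) (\<lambda>\<omega>. (past n \<omega>, V \<omega>)))"
    by (subst nn_integral_distr) auto
  also have "\<dots> = (\<integral>\<^sup>+u. \<integral>\<^sup>+v. F (u, v) \<partial>distr N ?T V \<partial>distr N (past_space n) (past n))"
    unfolding prod[symmetric] by (subst V.nn_integral_fst[symmetric]) auto
  also have "\<dots> = (\<integral>\<^sup>+u. H u * K (?Z u) \<partial>distr N (past_space n) (past n))"
  proof (rule nn_integral_cong)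
    fix u
    have sm: "(\<lambda>v. \<Sum>k<?Z u. v (n, k)) \<in> measurable ?T (count_space UNIV)"
      by (intro measurable_sum_nat measurable_component_singleton) auto
    have "(\<integral>\<^sup>+v. F (u, v) \<partial>distr N ?T V) = H u * (\<integral>\<^sup>+v. \<phi> (\<Sum>k<?Z u. v (n, k)) \<partial>distr N ?T V)"
      unfolding F_def using measurable_compose[OF sm, of \<phi> borel] by (simp add: nn_integral_cmult)
    also have "(\<integral>\<^sup>+v. \<phi> (\<Sum>k<?Z u. v (n, k)) \<partial>distr N ?T V) = (\<integral>\<^sup>+\<omega>. \<phi> (\<Sum>k<?Z u. V \<omega> (n, k)) \<partial>N)"
      using measurable_compose[OF sm, of \<phi> borel] by (subst nn_integral_distr) auto
    also have "\<dots> = K (?Z u)"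
      by (simp add: V_def K)
    finally show "(\<integral>\<^sup>+v. F (u, v) \<partial>distr N ?T V) = H u * K (?Z u)" .
  qed
  also have "\<dots> = (\<integral>\<^sup>+\<omega>. H (past n \<omega>) * K (?Z (past n \<omega>)) \<partial>N)"
    by (subst nn_integral_distr) auto
  also have "\<dots> = (\<integral>\<^sup>+\<omega>. indicator A \<omega> * K (GW X n \<omega>) \<partial>N)"
  proof (rule nn_integral_cong_AE)
    show "AE \<omega> in N. H (past n \<omega>) * K (?Z (past n \<omega>)) = indicator A \<omega> * K (GW X n \<omega>)"
      using A by eventually_elim (simp add: past_GW)
  qed
  finally show ?thesis .
qed

lemma GW_branching_power:
  assumes "A \<in> sets (GW_filtration M e X n)" "0 \<le> s" "s \<le> 1"
  shows "(\<integral>\<^sup>+\<omega>. indicator A \<omega> * ennreal (s ^ GW X (Suc n) \<omega>) \<partial>N)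
    = (\<integral>\<^sup>+\<omega>. indicator A \<omega> * ennreal (f n s ^ GW X n \<omega>) \<partial>N)"
proof (rule GW_branching[OF assms(1)])
  fix z
  \<comment> \<open>Independence of the family indexed by \<open>k\<close> alone: the doubly indexed
    family is restricted to the singletons \<open>{(n, k)}\<close> and the single coordinate is read
    off.\<close>
  have "indep_vars (\<lambda>k. PiM {(n, k)} (\<lambda>_. count_space UNIV))
      (\<lambda>k \<omega>. \<lambda>i\<in>{(n, k)}. (case i of (n, k) \<Rightarrow> X n k) \<omega>) {..<z}"
    by (rule indep_vars_restrict[OF indep_X]) (auto simp: disjoint_family_on_def)
  from indep_vars_compose2[OF this, where Y = "\<lambda>k u. ennreal (s ^ u (n, k))" and N = "\<lambda>_. borel"]
  have ind: "indep_vars (\<lambda>_. borel) (\<lambda>k \<omega>. ennreal (s ^ X n k \<omega>)) {..<z}"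
    by (simp add: measurable_compose[OF measurable_component_singleton])
  have "(\<integral>\<^sup>+\<omega>. ennreal (s ^ (\<Sum>k<z. X n k \<omega>)) \<partial>N) = (\<integral>\<^sup>+\<omega>. (\<Prod>k<z. ennreal (s ^ X n k \<omega>)) \<partial>N)"
    using assms by (simp add: power_sum prod_ennreal)
  also have "\<dots> = ennreal (f n s ^ z)"
    using assms X_pgf by (subst indep_vars_nn_integral[OF _ ind]) (auto simp: ennreal_power)
  finally show "(\<integral>\<^sup>+\<omega>. ennreal (s ^ (\<Sum>k<z. X n k \<omega>)) \<partial>N) = ennreal (f n s ^ z)" .
qed

lemma GW_branching_mean:
  assumes "A \<in> sets (GW_filtration M e X n)"
  shows "(\<integral>\<^sup>+\<omega>. indicator A \<omega> * of_nat (GW X (Suc n) \<omega>) \<partial>N)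
    = (\<integral>\<^sup>+\<omega>. indicator A \<omega> * (of_nat (GW X n \<omega>) * ennreal (envA \<eta> n powr (- 1 / \<theta>))) \<partial>N)"
proof (rule GW_branching[OF assms])
  fix z
  show "(\<integral>\<^sup>+\<omega>. of_nat (\<Sum>k<z. X n k \<omega>) \<partial>N) = of_nat z * ennreal (envA \<eta> n powr (- 1 / \<theta>))"
    by (simp add: of_nat_sum nn_integral_sum X_mean)
qed

section \<open>Quenched generating function and extinction by generation n\<close>

lemma space_in_filtration: "space N \<in> sets (GW_filtration M e X n)"
  using sets.top[of "GW_filtration M e X n"] by (simp add: space_N)

text \<open>The last generation is integrated out, so \<open>f n\<close> enters as the innermost map
  and \<open>s\<close> has to vary in the induction.\<close>

lemma GW_pgf_nn:
  assumes "0 \<le> s" "s \<le> 1"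
  shows "(\<integral>\<^sup>+\<omega>. ennreal (s ^ GW X n \<omega>) \<partial>N) = ennreal (PF_pgf \<theta> (Pi_env \<eta> n) (R_part \<eta> n) s)"
  using assms
proof (induction n arbitrary: s)
  case 0
  then show ?case
    using theta_pos by (simp add: PF_pgf_0_1 emeasure_space_1)
next
  case (Suc n)
  have "(\<integral>\<^sup>+\<omega>. ennreal (s ^ GW X (Suc n) \<omega>) \<partial>N) = (\<integral>\<^sup>+\<omega>. indicator (space N) \<omega> * ennreal (s ^ GW X (Suc n) \<omega>) \<partial>N)"
    by (intro nn_integral_cong) simp
  also have "\<dots> = (\<integral>\<^sup>+\<omega>. indicator (space N) \<omega> * ennreal (f n s ^ GW X n \<omega>) \<partial>N)"
    using Suc.prems by (rule GW_branching_power[OF space_in_filtration])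
  also have "\<dots> = (\<integral>\<^sup>+\<omega>. ennreal (f n s ^ GW X n \<omega>) \<partial>N)"
    by (intro nn_integral_cong) simp
  also have "\<dots> = ennreal (PF_pgf \<theta> (Pi_env \<eta> n) (R_part \<eta> n) (f n s))"
    using Suc.prems by (intro Suc.IH X_pgf)
  finally show ?case
    using theta_pos A_pos B_pos Suc.prems
    by (simp add: PF_pgf_compose less_imp_le Pi_env_Suc R_part_Suc del: GW.simps)
qed

text \<open>\<open>ennreal\<close> truncates negative numbers, so \<open>GW_pgf_nn\<close>
  determines the real value only together with this sign.\<close>

lemma PF_pgf_nonneg:
  assumes "0 \<le> s" "s \<le> 1"
  shows "0 \<le> PF_pgf \<theta> (Pi_env \<eta> n) (R_part \<eta> n) s"
  using assms
proof (induction n arbitrary: s)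
  case (Suc n)
  then have "0 \<le> PF_pgf \<theta> (Pi_env \<eta> n) (R_part \<eta> n) (f n s)"
    by (intro Suc.IH X_pgf)
  then show ?case
    using theta_pos A_pos B_pos Suc.prems
    by (simp add: PF_pgf_compose less_imp_le Pi_env_Suc R_part_Suc)
qed (simp add: PF_pgf_0_1 theta_pos)

lemma GW_pgf:
  assumes "0 \<le> s" "s \<le> 1"
  shows "(\<integral>\<omega>. s ^ GW X n \<omega> \<partial>N) = PF_pgf \<theta> (Pi_env \<eta> n) (R_part \<eta> n) s"
  using assms GW_pgf_nn[OF assms] PF_pgf_nonneg[OF assms]
  by (subst integral_eq_nn_integral) auto

lemma GW_extinct_prob:
  "measure N {\<omega> \<in> space M. GW X n \<omega> = 0} = 1 - (Pi_env \<eta> n + R_part \<eta> n) powr (- 1 / \<theta>)"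
proof -
  \<comment> \<open>Since \<open>0 ^ 0 = 1\<close>, the generating function at 0 integrates the
    indicator of extinction.\<close>
  have "(\<integral>\<omega>. 0 ^ GW X n \<omega> \<partial>N :: real) = (\<integral>\<omega>. indicator {\<omega> \<in> space N. GW X n \<omega> = 0} \<omega> \<partial>N)"
    by (intro Bochner_Integration.integral_cong) (auto simp: indicator_def)
  also have "\<dots> = measure N {\<omega> \<in> space N. GW X n \<omega> = 0}"
    by simp
  finally show ?thesis
    using GW_pgf[of 0 n] by (simp add: PF_pgf_def space_N)
qed

section \<open>The normalised martingale\<close>

lemma AE_W_proc: "AE \<omega> in N. \<forall>n. W_proc \<theta> e X n \<omega> = Pi_env \<eta> n powr (1 / \<theta>) * real (GW X n \<omega>)"
  using AE_env by eventually_elim (simp add: W_proc_def)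

lemma W_proc_nn_integral:
  assumes "A \<in> sets M"
  shows "(\<integral>\<^sup>+\<omega>. indicator A \<omega> * ennreal (W_proc \<theta> e X n \<omega>) \<partial>N)
    = ennreal (Pi_env \<eta> n powr (1 / \<theta>)) * (\<integral>\<^sup>+\<omega>. indicator A \<omega> * of_nat (GW X n \<omega>) \<partial>N)"
proof -
  have [measurable]: "A \<in> sets N" using assms by (simp add: sets_N)
  have "(\<integral>\<^sup>+\<omega>. indicator A \<omega> * ennreal (W_proc \<theta> e X n \<omega>) \<partial>N)
      = (\<integral>\<^sup>+\<omega>. ennreal (Pi_env \<eta> n powr (1 / \<theta>)) * (indicator A \<omega> * of_nat (GW X n \<omega>)) \<partial>N)"
  proof (rule nn_integral_cong_AE)
    show "AE \<omega> in N. indicator A \<omega> * ennreal (W_proc \<theta> e X n \<omega>)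
        = ennreal (Pi_env \<eta> n powr (1 / \<theta>)) * (indicator A \<omega> * of_nat (GW X n \<omega>))"
      using AE_W_proc
      by eventually_elim (simp add: ennreal_mult ennreal_of_nat_eq_real_of_nat mult_ac)
  qed
  then show ?thesis
    by (simp add: nn_integral_cmult)
qed

text \<open>The offspring mean \<open>envA \<eta> n powr (- 1 / \<theta>)\<close> cancels the new
  factor in \<open>Pi_env \<eta> (Suc n) powr (1 / \<theta>)\<close>.\<close>

lemma W_proc_step:
  assumes "A \<in> sets (GW_filtration M e X n)"
  shows "(\<integral>\<^sup>+\<omega>. indicator A \<omega> * ennreal (W_proc \<theta> e X (Suc n) \<omega>) \<partial>N)
    = (\<integral>\<^sup>+\<omega>. indicator A \<omega> * ennreal (W_proc \<theta> e X n \<omega>) \<partial>N)"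
proof -
  have A: "A \<in> sets M" and [measurable]: "A \<in> sets N"
    using assms filtration_subalgebra[of n] by (auto simp: subalgebra_def sets_N)
  have "Pi_env \<eta> (Suc n) powr (1 / \<theta>) * envA \<eta> n powr (- 1 / \<theta>) = Pi_env \<eta> n powr (1 / \<theta>)"
    using Pi_pos[of n] A_pos[of n] by (simp add: Pi_env_Suc powr_mult powr_minus)
  then have *: "ennreal (Pi_env \<eta> (Suc n) powr (1 / \<theta>)) * ennreal (envA \<eta> n powr (- 1 / \<theta>)) = ennreal (Pi_env \<eta> n powr (1 / \<theta>))"
    by (simp add: ennreal_mult[symmetric])
  have mean: "(\<integral>\<^sup>+\<omega>. indicator A \<omega> * (of_nat (GW X n \<omega>) * ennreal (envA \<eta> n powr (- 1 / \<theta>))) \<partial>N)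
      = ennreal (envA \<eta> n powr (- 1 / \<theta>)) * (\<integral>\<^sup>+\<omega>. indicator A \<omega> * of_nat (GW X n \<omega>) \<partial>N)"
    by (subst nn_integral_cmult[symmetric]) (auto simp: mult_ac)
  show ?thesis
    unfolding W_proc_nn_integral[OF A] GW_branching_mean[OF assms] mean
    by (simp only: mult.assoc[symmetric] *)
qed

lemma W_proc_mean_nn: "(\<integral>\<^sup>+\<omega>. ennreal (W_proc \<theta> e X n \<omega>) \<partial>N) = 1"
proof -
  have "(\<integral>\<^sup>+\<omega>. indicator (space N) \<omega> * ennreal (W_proc \<theta> e X n \<omega>) \<partial>N) = 1"
  proof (induction n)
    case (Suc n)
    then show ?case by (simp add: W_proc_step[OF space_in_filtration])
  qed (simp add: W_proc_def emeasure_space_1)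
  then show ?thesis
    by (simp cong: nn_integral_cong_simp)
qed

lemma W_proc_integrable: "integrable N (W_proc \<theta> e X n)"
  by (rule integrableI_nonneg) (auto simp: W_proc_nonneg W_proc_mean_nn)

lemma W_proc_mean: "(\<integral>\<omega>. W_proc \<theta> e X n \<omega> \<partial>N) = 1"
  by (subst integral_eq_nn_integral) (auto simp: W_proc_nonneg W_proc_mean_nn)

lemma W_proc_martingale: "is_martingale N (GW_filtration M e X) (W_proc \<theta> e X)"
  by (intro is_martingale_nn_stepI filtration_subalgebra GW_filtration_mono measurable_GW_filtration_W_proc
      W_proc_integrable W_proc_nonneg W_proc_step)

end

section \<open>The limit of the normalised process\<close>

text \<open>A lower limit, so that one measurable variable is fixed on the whole sample space before
  any environment is chosen and serves all quenched measures at once. Where the lower limit is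
  infinite, \<open>enn2real\<close> yields 0.\<close>

definition W_lim :: "real \<Rightarrow> (nat \<Rightarrow> 'a \<Rightarrow> real \<times> real) \<Rightarrow> (nat \<Rightarrow> nat \<Rightarrow> 'a \<Rightarrow> nat) \<Rightarrow> 'a \<Rightarrow> real" where
  "W_lim \<theta> e X \<omega> = enn2real (liminf (\<lambda>n. ennreal (W_proc \<theta> e X n \<omega>)))"

lemma W_lim_nonneg: "0 \<le> W_lim \<theta> e X \<omega>"
  by (simp add: W_lim_def)

lemma W_lim_eq:
  assumes "(\<lambda>n. W_proc \<theta> e X n \<omega>) \<longlonglongrightarrow> l"
  shows "W_lim \<theta> e X \<omega> = l"
proof -
  have "0 \<le> l"
    using assms by (rule LIMSEQ_le_const) (auto simp: W_proc_nonneg)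
  then show ?thesis
    using lim_imp_Liminf[OF _ tendsto_ennrealI[OF assms]] by (simp add: W_lim_def)
qed

lemma measurable_W_lim:
  assumes "\<And>n. W_proc \<theta> e X n \<in> borel_measurable M"
  shows "W_lim \<theta> e X \<in> borel_measurable M"
  unfolding W_lim_def[abs_def] using assms by measurable

lemma exp_slope_le:
  fixes u w :: real
  assumes "0 < u"
  shows "(1 - exp (- u * w)) / u \<le> w"
  using assms exp_ge_add_one_self[of "- u * w"] by (simp add: field_simps)

lemma tendsto_exp_slope:
  fixes w :: real
  assumes "u \<longlonglongrightarrow> 0" "\<And>n. 0 < u n"
  shows "(\<lambda>n. (1 - exp (- u n * w)) / u n) \<longlonglongrightarrow> w"
proof -
  have "((\<lambda>x. 1 - exp (- x * w)) has_real_derivative w) (at 0)"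
    by (auto intro!: derivative_eq_intros)
  then have "((\<lambda>x. (1 - exp (- x * w)) / x) \<longlongrightarrow> w) (at 0)"
    by (simp add: has_field_derivative_iff)
  moreover have "filterlim u (at 0) sequentially"
    using assms by (auto simp: filterlim_at less_imp_neq[symmetric])
  ultimately show ?thesis
    by (rule filterlim_compose)
qed

context quenched_GW
begin

text \<open>The generating functions map \<open>sol (Suc n)\<close> to \<open>sol n\<close>: it is the backward solution for which
  \<open>\<Pi>\<^sub>n / (1 - sol n) powr \<theta> + R\<^sub>n\<close> has the constant value \<open>R\<^sub>\<infinity> + 1\<close>. Hence
  \<open>sol n ^ Z\<^sub>n\<close> is a bounded martingale. Since \<open>- ln (sol n)\<close> is equivalent to
  \<open>\<Pi>\<^sub>n powr (1 / \<theta>)\<close>, its convergence yields that of \<open>W\<^sub>n\<close>.\<close>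

definition sol :: "nat \<Rightarrow> real" where
  "sol n = 1 - ((R_inf \<eta> + 1 - R_part \<eta> n) / Pi_env \<eta> n) powr (- 1 / \<theta>)"

text \<open>Without the added 1 the ratio would be the series of the environment after time
  \<open>n\<close>, and \<open>sol n\<close> its extinction probability. The numerator would then
  tend to 0, and \<open>1 - sol n\<close> would no longer be comparable with
  \<open>Pi_env \<eta> n powr (1 / \<theta>)\<close>.\<close>

lemma sol_ratio_gt_1: "1 < (R_inf \<eta> + 1 - R_part \<eta> n) / Pi_env \<eta> n"
  using Pi_R_part_le[of n] Pi_pos[of n] by (simp add: field_simps)

lemma sol_pos: "0 < sol n" and sol_less_1: "sol n < 1"
proof -
  define c where "c = (R_inf \<eta> + 1 - R_part \<eta> n) / Pi_env \<eta> n"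
  have c: "1 < c"
    unfolding c_def by (rule sol_ratio_gt_1)
  have "c powr (- 1 / \<theta>) < c powr 0"
    using c theta_pos by (intro powr_less_mono) auto
  with c show "0 < sol n" and "sol n < 1"
    by (simp_all add: sol_def c_def[symmetric])
qed

lemma f_sol: "f n (sol (Suc n)) = sol n"
proof -
  let ?c = "(R_inf \<eta> + 1 - R_part \<eta> (Suc n)) / Pi_env \<eta> (Suc n)"
  have c: "0 < ?c" using sol_ratio_gt_1[of "Suc n"] by linarith
  have "f n (sol (Suc n)) = 1 - (envA \<eta> n / (?c powr (- 1 / \<theta>)) powr \<theta> + envB \<eta> n) powr (- 1 / \<theta>)"
    using sol_less_1[of "Suc n"] by (simp add: PF_pgf_def) (simp add: sol_def)
  also have "envA \<eta> n / (?c powr (- 1 / \<theta>)) powr \<theta> + envB \<eta> n = envA \<eta> n * ?c + envB \<eta> n"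
    using powr_neg_inverse_powr[OF c theta_pos] by simp
  also have "\<dots> = (R_inf \<eta> + 1 - R_part \<eta> n) / Pi_env \<eta> n"
    using Pi_pos[of n] A_pos[of n] by (simp add: Pi_env_Suc R_part_Suc field_simps)
  finally show ?thesis by (simp add: sol_def)
qed

lemma sol_martingale: "is_martingale N (GW_filtration M e X) (\<lambda>n \<omega>. sol n ^ GW X n \<omega>)"
proof (intro is_martingale_nn_stepI filtration_subalgebra GW_filtration_mono)
  show "(\<lambda>\<omega>. sol n ^ GW X n \<omega>) \<in> borel_measurable (GW_filtration M e X n)" for n
    using measurable_compose[OF measurable_GW_filtration_GW, of "\<lambda>k. sol n ^ k" borel] by simp
  show "integrable N (\<lambda>\<omega>. sol n ^ GW X n \<omega>)" for n
    using sol_pos[of n] sol_less_1[of n]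
    by (intro bdd_integrable[where K = 1]) (auto simp: power_le_one)
  show "0 \<le> sol n ^ GW X n \<omega>" for n \<omega>
    using sol_pos[of n] by simp
  show "(\<integral>\<^sup>+\<omega>. indicator A \<omega> * ennreal (sol (Suc n) ^ GW X (Suc n) \<omega>) \<partial>N)
      = (\<integral>\<^sup>+\<omega>. indicator A \<omega> * ennreal (sol n ^ GW X n \<omega>) \<partial>N)"
    if "A \<in> sets (GW_filtration M e X n)" for A n
    using GW_branching_power[OF that, of "sol (Suc n)"] sol_pos[of "Suc n"] sol_less_1[of "Suc n"]
    by (simp add: f_sol del: GW.simps)
qed

text \<open>\<open>1 - sol n\<close> is \<open>Pi_env \<eta> n powr (1 / \<theta>)\<close> times a
  factor tending to 1, and \<open>- ln (1 - x)\<close> has slope 1 at 0.\<close>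

lemma sol_rate: "(\<lambda>n. - ln (sol n) / Pi_env \<eta> n powr (1 / \<theta>)) \<longlonglongrightarrow> 1"
proof -
  define d where "d n = 1 - sol n" for n
  have d: "0 < d n" for n using sol_less_1[of n] by (simp add: d_def)
  have d_eq: "d n = (R_inf \<eta> + 1 - R_part \<eta> n) powr (- 1 / \<theta>) * Pi_env \<eta> n powr (1 / \<theta>)" for n
    using Pi_R_part_le[of n] Pi_pos[of n] by (simp add: d_def sol_def powr_divide powr_minus) (simp add: divide_inverse mult.commute)
  have pi: "(\<lambda>n. Pi_env \<eta> n powr (1 / \<theta>)) \<longlonglongrightarrow> 0"
    using tendsto_powr2[OF Pi_lim tendsto_const[of "1 / \<theta>"]] theta_pos Pi_pos by (simp add: less_imp_le)
  have c: "(\<lambda>n. (R_inf \<eta> + 1 - R_part \<eta> n) powr (- 1 / \<theta>)) \<longlonglongrightarrow> 1"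
    using tendsto_powr[OF tendsto_diff[OF tendsto_const[of "R_inf \<eta> + 1"] R_part_lim] tendsto_const[of "- 1 / \<theta>"]]
    by simp
  have "d \<longlonglongrightarrow> 0"
    unfolding d_eq[abs_def] using tendsto_mult[OF c pi] by simp
  then have "filterlim d (at 0) sequentially"
    using d by (auto simp: filterlim_at less_imp_neq[symmetric])
  moreover have "((\<lambda>x. - ln (1 - x)) has_real_derivative 1) (at 0)"
    by (auto intro!: derivative_eq_intros)
  then have "((\<lambda>x. - ln (1 - x) / x) \<longlongrightarrow> 1) (at (0 :: real))"
    by (simp add: has_field_derivative_iff)
  ultimately have "(\<lambda>n. - ln (1 - d n) / d n) \<longlonglongrightarrow> 1"
    by (rule filterlim_compose[rotated])
  from tendsto_mult[OF this c]
  have "(\<lambda>n. - ln (1 - d n) / d n * (R_inf \<eta> + 1 - R_part \<eta> n) powr (- 1 / \<theta>)) \<longlonglongrightarrow> 1"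
    by simp
  moreover have "- ln (1 - d n) / d n * (R_inf \<eta> + 1 - R_part \<eta> n) powr (- 1 / \<theta>)
      = - ln (sol n) / Pi_env \<eta> n powr (1 / \<theta>)" for n
  proof -
    have *: "1 - d n = sol n" by (simp add: d_def)
    show ?thesis
      unfolding * using Pi_pos[of n] Pi_R_part_le[of n] by (simp add: d_eq)
  qed
  ultimately show ?thesis by simp
qed

text \<open>By Fatou's lemma and the constant mean 1 the lower limit is almost surely finite. This
  excludes the limit 0 for \<open>sol n ^ GW X n\<close>, the one case in which logarithms could not
  be taken.\<close>

lemma AE_W_proc_frequently_bounded:
  "AE \<omega> in N. \<exists>K. \<exists>\<^sub>F n in sequentially. W_proc \<theta> e X n \<omega> < K"
proof -
  have "(\<integral>\<^sup>+\<omega>. liminf (\<lambda>n. ennreal (W_proc \<theta> e X n \<omega>)) \<partial>N)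
      \<le> liminf (\<lambda>n. \<integral>\<^sup>+\<omega>. ennreal (W_proc \<theta> e X n \<omega>) \<partial>N)"
    by (rule nn_integral_liminf) measurable
  also have "\<dots> = 1"
    by (simp add: W_proc_mean_nn Liminf_const)
  finally have "(\<integral>\<^sup>+\<omega>. liminf (\<lambda>n. ennreal (W_proc \<theta> e X n \<omega>)) \<partial>N) \<noteq> \<infinity>"
    by (auto simp: top_unique)
  then have "AE \<omega> in N. liminf (\<lambda>n. ennreal (W_proc \<theta> e X n \<omega>)) \<noteq> \<infinity>"
    by (intro nn_integral_noteq_infinite) auto
  then show ?thesis
  proof eventually_elim
    case (elim \<omega>)
    then obtain r where r: "0 \<le> r" "liminf (\<lambda>n. ennreal (W_proc \<theta> e X n \<omega>)) = ennreal r"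
      by (cases "liminf (\<lambda>n. ennreal (W_proc \<theta> e X n \<omega>))") auto
    have "\<exists>\<^sub>F n in sequentially. W_proc \<theta> e X n \<omega> < r + 1"
    proof (rule ccontr)
      assume "\<not> ?thesis"
      then have "\<forall>\<^sub>F n in sequentially. ennreal (r + 1) \<le> ennreal (W_proc \<theta> e X n \<omega>)"
        by (auto simp: frequently_def not_less intro: ennreal_leI elim: eventually_mono)
      then have "ennreal (r + 1) \<le> ennreal r"
        unfolding r(2)[symmetric] by (rule Liminf_bounded)
      with r show False by simp
    qed
    then show ?case by blast
  qed
qed

lemma AE_W_proc_convergent: "AE \<omega> in N. convergent (\<lambda>n. W_proc \<theta> e X n \<omega>)"
proof -
  have "AE \<omega> in N. convergent (\<lambda>n. sol n ^ GW X n \<omega>)"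
    using sol_pos sol_less_1
    by (intro bounded_martingale_convergent[OF sol_martingale, where C = 1]) (auto simp: power_le_one less_imp_le)
  from this AE_W_proc_frequently_bounded AE_W_proc
  show ?thesis
  proof eventually_elim
    case (elim \<omega>)
    let ?\<rho> = "\<lambda>n. - ln (sol n) / Pi_env \<eta> n powr (1 / \<theta>)"
    let ?W = "\<lambda>n. W_proc \<theta> e X n \<omega>"
    have power_eq: "sol n ^ GW X n \<omega> = exp (- (?\<rho> n * ?W n))" for n
    proof -
      have "?\<rho> n * ?W n = real (GW X n \<omega>) * (- ln (sol n))"
        using elim(3) Pi_pos[of n] by simp
      then show ?thesis
        using sol_pos[of n] by (simp add: exp_of_nat_mult)
    qed
    obtain y where y: "(\<lambda>n. sol n ^ GW X n \<omega>) \<longlonglongrightarrow> y"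
      using elim(1) by (auto simp: convergent_def)
    obtain K where K: "\<exists>\<^sub>F n in sequentially. ?W n < K"
      using elim(2) by blast
    \<comment> \<open>Infinitely often \<open>?W n < K\<close>, while \<open>?\<rho> n < 2\<close>
      eventually since it tends to 1; hence the powers exceed this bound infinitely often.\<close>
    have "exp (- (2 * K)) \<le> y"
    proof (rule ccontr)
      assume "\<not> ?thesis"
      then have "\<forall>\<^sub>F n in sequentially. sol n ^ GW X n \<omega> < exp (- (2 * K))"
        by (intro order_tendstoD(2)[OF y]) simp
      moreover have "\<forall>\<^sub>F n in sequentially. ?\<rho> n < 2"
        by (rule order_tendstoD(2)[OF sol_rate]) simp
      ultimately have "\<forall>\<^sub>F n in sequentially. \<not> ?W n < K"
      proof eventually_elim
        case (elim n)
        then have "2 * K < ?\<rho> n * ?W n"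
          by (simp add: power_eq)
        also have "\<dots> \<le> 2 * ?W n"
          using elim(2) by (intro mult_right_mono W_proc_nonneg) auto
        finally show ?case by simp
      qed
      with K show False by (simp add: frequently_def)
    qed
    then have "0 < y"
      by (rule less_le_trans[rotated]) simp
    then have "(\<lambda>n. - ln (sol n ^ GW X n \<omega>) / ?\<rho> n) \<longlonglongrightarrow> - ln y / 1"
      by (intro tendsto_intros y sol_rate) auto
    moreover have "- ln (sol n ^ GW X n \<omega>) / ?\<rho> n = ?W n" for n
    proof -
      have "ln (sol n) < 0" using sol_pos[of n] sol_less_1[of n] by simp
      then have "?\<rho> n \<noteq> 0" using Pi_pos[of n] by simp
      then show ?thesis unfolding power_eq ln_exp by simp
    qed
    ultimately show ?case
      by (auto simp: convergent_def)
  qed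
qed

section \<open>Law and mean of the limit\<close>

abbreviation W :: "'a \<Rightarrow> real" where
  "W \<equiv> W_lim \<theta> e X"

lemma W_meas [measurable]: "W \<in> borel_measurable N"
  by (rule measurable_W_lim) measurable

lemma AE_W_proc_tendsto: "AE \<omega> in N. (\<lambda>n. W_proc \<theta> e X n \<omega>) \<longlonglongrightarrow> W \<omega>"
  using AE_W_proc_convergent
proof eventually_elim
  case (elim \<omega>)
  then obtain l where "(\<lambda>n. W_proc \<theta> e X n \<omega>) \<longlonglongrightarrow> l"
    by (auto simp: convergent_def)
  then show ?case by (simp add: W_lim_eq)
qed

text \<open>Dominated convergence, with the generating function of \<open>GW X n\<close> evaluated
  at an exponential. The value is written as \<open>PF_pgf\<close> at \<open>1 - u\<close>, a purely
  formal argument for \<open>u > 1\<close>, so that the lemmas on composition and slope apply to it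
  as they stand.\<close>

lemma W_laplace:
  assumes u: "0 < u"
  shows "(\<integral>\<omega>. exp (- u * W \<omega>) \<partial>N) = PF_pgf \<theta> 1 (R_inf \<eta>) (1 - u)"
proof -
  let ?t = "\<lambda>n. Pi_env \<eta> n powr (1 / \<theta>)"
  have t_pos: "0 < ?t n" for n using Pi_pos[of n] by simp
  have t_lim: "?t \<longlonglongrightarrow> 0"
    using tendsto_powr2[OF Pi_lim tendsto_const[of "1 / \<theta>"]] theta_pos Pi_pos by (simp add: less_imp_le)
  have "(\<lambda>n. \<integral>\<omega>. exp (- u * W_proc \<theta> e X n \<omega>) \<partial>N) \<longlonglongrightarrow> (\<integral>\<omega>. exp (- u * W \<omega>) \<partial>N)"
  proof (rule integral_dominated_convergence[where w = "\<lambda>_. 1"])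
    show "AE \<omega> in N. (\<lambda>n. exp (- u * W_proc \<theta> e X n \<omega>)) \<longlonglongrightarrow> exp (- u * W \<omega>)"
      using AE_W_proc_tendsto by eventually_elim (intro tendsto_intros)
    show "AE \<omega> in N. norm (exp (- u * W_proc \<theta> e X n \<omega>)) \<le> 1" for n
      using u by (auto simp: W_proc_nonneg)
  qed auto
  moreover have "(\<integral>\<omega>. exp (- u * W_proc \<theta> e X n \<omega>) \<partial>N)
      = 1 - (((1 - exp (- ?t n * u)) / ?t n) powr (- \<theta>) + R_part \<eta> n) powr (- 1 / \<theta>)" for n
  proof -
    have s: "0 \<le> exp (- ?t n * u)" "exp (- ?t n * u) < 1"
      using u t_pos[of n] by auto
    have "(\<integral>\<omega>. exp (- u * W_proc \<theta> e X n \<omega>) \<partial>N) = (\<integral>\<omega>. exp (- ?t n * u) ^ GW X n \<omega> \<partial>N)"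
    proof (rule integral_cong_AE)
      show "AE \<omega> in N. exp (- u * W_proc \<theta> e X n \<omega>) = exp (- ?t n * u) ^ GW X n \<omega>"
        using AE_W_proc by eventually_elim (simp add: exp_of_nat_mult[symmetric] mult_ac)
    qed measurable
    also have "\<dots> = PF_pgf \<theta> (Pi_env \<eta> n) (R_part \<eta> n) (exp (- ?t n * u))"
      using s by (intro GW_pgf) auto
    also have "\<dots> = 1 - (Pi_env \<eta> n / (1 - exp (- ?t n * u)) powr \<theta> + R_part \<eta> n) powr (- 1 / \<theta>)"
      using s(2) unfolding PF_pgf_def by (simp only: less_imp_neq if_False)
    \<comment> \<open>As \<open>Pi_env \<eta> n = ?t n powr \<theta>\<close>, the product is
      absorbed into a difference quotient of the exponential, which tends to
      \<open>u\<close>.\<close>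
    also have "Pi_env \<eta> n / (1 - exp (- ?t n * u)) powr \<theta> = ((1 - exp (- ?t n * u)) / ?t n) powr (- \<theta>)"
      using s Pi_pos[of n] theta_pos by (simp add: powr_divide powr_powr powr_minus field_simps)
    finally show ?thesis .
  qed
  moreover have "(\<lambda>n. 1 - (((1 - exp (- ?t n * u)) / ?t n) powr (- \<theta>) + R_part \<eta> n) powr (- 1 / \<theta>))
      \<longlonglongrightarrow> 1 - (u powr (- \<theta>) + R_inf \<eta>) powr (- 1 / \<theta>)"
  proof -
    have "0 < u powr (- \<theta>) + R_inf \<eta>"
      using u R_inf_pos by (intro add_pos_pos) auto
    then show ?thesis
      using u by (intro tendsto_diff tendsto_const tendsto_powr[OF _ tendsto_const] tendsto_add
          tendsto_exp_slope[OF t_lim t_pos] R_part_lim) auto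
  qed
  ultimately have "(\<integral>\<omega>. exp (- u * W \<omega>) \<partial>N) = 1 - (u powr (- \<theta>) + R_inf \<eta>) powr (- 1 / \<theta>)"
    using LIMSEQ_unique by simp
  then show ?thesis
    using u by (simp add: PF_pgf_def powr_minus divide_inverse)
qed

lemma W_mean_nn: "(\<integral>\<^sup>+\<omega>. ennreal (W \<omega>) \<partial>N) = 1"
proof -
  define u where "u n = inverse (real (Suc n))" for n
  have u: "0 < u n" for n by (simp add: u_def)
  have u_lim: "u \<longlonglongrightarrow> 0"
    unfolding u_def[abs_def] by (rule LIMSEQ_inverse_real_of_nat)
  define g where "g n \<omega> = ennreal ((1 - exp (- u n * W \<omega>)) / u n)" for n \<omega>
  show ?thesis
  proof (rule nn_integral_limit_from_below[where g = g])
    show "g n \<in> borel_measurable N" for n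
      unfolding g_def[abs_def] by measurable
    show "AE \<omega> in N. g n \<omega> \<le> ennreal (W \<omega>)" for n
      using exp_slope_le[OF u] by (auto simp: g_def intro!: ennreal_leI)
    show "AE \<omega> in N. (\<lambda>n. g n \<omega>) \<longlonglongrightarrow> ennreal (W \<omega>)"
      unfolding g_def by (intro AE_I2 tendsto_ennrealI tendsto_exp_slope u_lim u)
    have "(\<integral>\<^sup>+\<omega>. g n \<omega> \<partial>N) = ennreal ((1 - PF_pgf \<theta> 1 (R_inf \<eta>) (1 - u n)) / u n)" for n
    proof -
      have int: "integrable N (\<lambda>\<omega>. exp (- u n * W \<omega>))"
        using u[of n] by (intro bdd_integrable[where K = 1]) (auto simp: W_lim_nonneg)
      have "(\<integral>\<^sup>+\<omega>. g n \<omega> \<partial>N) = ennreal (\<integral>\<omega>. (1 - exp (- u n * W \<omega>)) / u n \<partial>N)"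
        unfolding g_def using u[of n] int
        by (intro nn_integral_eq_integral) (auto intro!: divide_nonneg_pos simp: W_lim_nonneg)
      also have "(\<integral>\<omega>. (1 - exp (- u n * W \<omega>)) / u n \<partial>N) = (1 - PF_pgf \<theta> 1 (R_inf \<eta>) (1 - u n)) / u n"
        using int W_laplace[OF u[of n]] by (simp add: prob_space)
      finally show ?thesis .
    qed
    moreover have "(\<lambda>n. (1 - PF_pgf \<theta> 1 (R_inf \<eta>) (1 - u n)) / u n) \<longlonglongrightarrow> 1 powr (- 1 / \<theta>)"
      using R_inf_pos by (intro tendsto_PF_pgf_slope theta_pos u_lim u) auto
    ultimately show "(\<lambda>n. \<integral>\<^sup>+\<omega>. g n \<omega> \<partial>N) \<longlonglongrightarrow> 1"
      using tendsto_ennrealI by fastforce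
  qed
qed

lemma W_integrable: "integrable N W"
  by (rule integrableI_nonneg) (auto simp: W_lim_nonneg W_mean_nn)

lemma W_proc_L1: "(\<lambda>n. \<integral>\<omega>. \<bar>W_proc \<theta> e X n \<omega> - W \<omega>\<bar> \<partial>N) \<longlonglongrightarrow> 0"
proof -
  have "(\<lambda>n. \<integral>\<^sup>+\<omega>. norm (W_proc \<theta> e X n \<omega> - W \<omega>) \<partial>N) \<longlonglongrightarrow> 0"
    by (rule Scheffe_lemma2[OF W_proc_meas W_integrable AE_W_proc_tendsto])
       (simp add: W_proc_nonneg W_lim_nonneg W_proc_mean_nn W_mean_nn)
  then have "(\<lambda>n. enn2real (\<integral>\<^sup>+\<omega>. norm (W_proc \<theta> e X n \<omega> - W \<omega>) \<partial>N)) \<longlonglongrightarrow> 0"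
    by (intro tendsto_enn2real) auto
  moreover have "enn2real (\<integral>\<^sup>+\<omega>. norm (W_proc \<theta> e X n \<omega> - W \<omega>) \<partial>N) = (\<integral>\<omega>. \<bar>W_proc \<theta> e X n \<omega> - W \<omega>\<bar> \<partial>N)" for n
    by (subst integral_eq_nn_integral) auto
  ultimately show ?thesis by simp
qed

lemma W_laplace':
  assumes "0 \<le> u"
  shows "(\<integral>\<omega>. exp (- u * W \<omega>) \<partial>N) =
    (if u = 0 then 1 else 1 - (1 / u powr \<theta> + R_inf \<eta>) powr (- 1 / \<theta>))"
  using assms W_laplace[of u] by (auto simp: PF_pgf_def prob_space)

lemma W_CPF_law: "CPF_law \<theta> 1 (R_inf \<eta>) (distr N borel W)"
  unfolding CPF_law_def
proof (intro conjI allI impI)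
  show "prob_space (distr N borel W)"
    by (rule prob_space_distr) measurable
  show "AE x in distr N borel W. 0 \<le> x"
    by (subst AE_distr_iff) (auto simp: W_lim_nonneg)
  show "(\<integral>x. exp (- u * x) \<partial>distr N borel W) = CPF_laplace \<theta> 1 (R_inf \<eta>) u" if "0 \<le> u" for u
    using that W_laplace'[OF that]
    by (subst integral_distr) (auto simp: CPF_laplace_def powr_minus divide_inverse)
qed (use theta_pos theta_le_1 R_inf_ge_1 in auto)

end

section \<open>Random environments\<close>

lemma (in prob_space) indep_vars_reindex:
  assumes "indep_vars M' X I" "inj_on h J" "h ` J \<subseteq> I"
  shows "indep_vars (\<lambda>j. M' (h j)) (\<lambda>j. X (h j)) J"
proof -
  have "indep_vars (\<lambda>j. PiM {h j} M') (\<lambda>j \<omega>. \<lambda>i\<in>{h j}. X i \<omega>) J"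
    using assms by (intro indep_vars_restrict[OF assms(1)]) (auto simp: disjoint_family_on_def inj_on_def)
  from indep_vars_compose2[OF this, where Y = "\<lambda>j u. u (h j)" and N = "\<lambda>j. M' (h j)"]
  show ?thesis by simp
qed

lemma iid_env_measurable: "prob_space M \<Longrightarrow> iid_env M e \<Longrightarrow> e n \<in> measurable M borel"
  by (simp add: iid_env_def prob_space.indep_vars_def)

text \<open>Both laws are the same infinite product of the common marginal.\<close>

lemma distr_env_shift:
  assumes "prob_space M" "iid_env M e"
  shows "distr M env_space (env_of e) = distr M env_space (\<lambda>\<omega>. env_shift (env_of e \<omega>))"
proof -
  interpret prob_space M by fact
  note [measurable] = iid_env_measurable[OF assms]
  have ind: "indep_vars (\<lambda>_. borel) e UNIV" and id: "distr M borel (e n) = distr M borel (e 0)" for n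
    using assms(2) by (auto simp: iid_env_def)
  have ind': "indep_vars (\<lambda>_. borel) (\<lambda>n. e (Suc n)) UNIV"
    using indep_vars_reindex[OF ind, of Suc UNIV] by simp
  have "distr M env_space (\<lambda>\<omega>. \<lambda>n\<in>UNIV. e n \<omega>) = PiM UNIV (\<lambda>n. distr M borel (e n))"
    by (rule indep_vars_iff_distr_eq_PiM[THEN iffD1, OF _ _ ind]) auto
  moreover have "distr M env_space (\<lambda>\<omega>. \<lambda>n\<in>UNIV. e (Suc n) \<omega>) = PiM UNIV (\<lambda>n. distr M borel (e (Suc n)))"
    by (rule indep_vars_iff_distr_eq_PiM[THEN iffD1, OF _ _ ind']) auto
  moreover have "PiM UNIV (\<lambda>n. distr M borel (e (Suc n))) = PiM UNIV (\<lambda>n. distr M borel (e n))"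
    by (intro PiM_cong refl) (metis id)
  ultimately show ?thesis
    by (simp add: env_shift_def restrict_UNIV)
qed

text \<open>Almost sure validity of a measurable property depends on the law of the environment
  alone. This gives meaning to quenched functionals at the shifted environment although they are
  fixed only up to null sets.\<close>

lemma AE_env_shift:
  assumes "prob_space M" "iid_env M e"
    and Q: "{\<eta> \<in> space env_space. Q \<eta>} \<in> sets env_space"
    and AE: "AE \<omega> in M. Q (env_of e \<omega>)"
  shows "AE \<omega> in M. Q (env_shift (env_of e \<omega>))"
proof -
  note e = iid_env_measurable[OF assms(1,2)]
  have meas: "env_of e \<in> measurable M env_space"
    by (rule measurable_env_of[OF e])
  have meas_shift: "(\<lambda>\<omega>. env_shift (env_of e \<omega>)) \<in> measurable M env_space"
    unfolding env_shift_def by (rule measurable_env_of[OF e])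
  show ?thesis
    using AE AE_distr_iff[OF meas Q] AE_distr_iff[OF meas_shift Q]
    unfolding distr_env_shift[OF assms(1,2)] by blast
qed

lemma subalgebra_sigma_env:
  assumes "\<And>n. e n \<in> measurable M borel"
  shows "subalgebra M (sigma_env M e)"
  unfolding subalgebra_def sigma_env_def
  using sets_image_in_sets[OF refl measurable_env_of[where e = e and M = M]] assms by simp

lemma measurable_sigma_env: "env_of e \<in> measurable (sigma_env M e) env_space"
  unfolding sigma_env_def by (rule measurable_vimage_algebra1) (auto simp: space_PiM)

lemma measurable_sigma_env_component: "e n \<in> measurable (sigma_env M e) borel"
  using measurable_compose[OF measurable_sigma_env measurable_component_singleton[of n UNIV "\<lambda>_. borel"]]
  by simp

lemma measurable_sigma_env_upto:
  "(\<lambda>\<omega>. \<lambda>k\<in>{..<n}. e k \<omega>) \<in> measurable (sigma_env_upto M e n) (PiM {..<n} (\<lambda>_. borel))"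
  unfolding sigma_env_upto_def by (rule measurable_vimage_algebra1) (auto simp: space_PiM)

lemma subalgebra_sigma_env_upto: "subalgebra (sigma_env M e) (sigma_env_upto M e n)"
  unfolding subalgebra_def
proof
  show space: "space (sigma_env_upto M e n) = space (sigma_env M e)"
    by (simp add: sigma_env_def sigma_env_upto_def)
  show "sets (sigma_env_upto M e n) \<subseteq> sets (sigma_env M e)"
    unfolding sigma_env_upto_def
    by (rule sets_image_in_sets) (auto simp: sigma_env_def[of M e, THEN arg_cong[where f = space]]
        intro!: measurable_restrict measurable_sigma_env_component)
qed

lemma measurable_sigma_env_upto_fst_snd:
  assumes "k < n"
  shows "(\<lambda>\<omega>. envA (env_of e \<omega>) k) \<in> borel_measurable (sigma_env_upto M e n)"
    and "(\<lambda>\<omega>. envB (env_of e \<omega>) k) \<in> borel_measurable (sigma_env_upto M e n)"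
proof -
  have "(\<lambda>\<omega>. (\<lambda>k\<in>{..<n}. e k \<omega>) k) \<in> measurable (sigma_env_upto M e n) borel"
    by (rule measurable_compose[OF measurable_sigma_env_upto measurable_component_singleton]) (use assms in simp)
  then have ek: "e k \<in> measurable (sigma_env_upto M e n) borel"
    using assms by simp
  have "(\<lambda>\<omega>. fst (e k \<omega>)) \<in> borel_measurable (sigma_env_upto M e n)"
    by (rule measurable_compose[OF ek, of fst]) (auto intro!: borel_measurable_continuous_onI continuous_intros)
  moreover have "(\<lambda>\<omega>. snd (e k \<omega>)) \<in> borel_measurable (sigma_env_upto M e n)"
    by (rule measurable_compose[OF ek, of snd]) (auto intro!: borel_measurable_continuous_onI continuous_intros)
  ultimately show "(\<lambda>\<omega>. envA (env_of e \<omega>) k) \<in> borel_measurable (sigma_env_upto M e n)"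
    and "(\<lambda>\<omega>. envB (env_of e \<omega>) k) \<in> borel_measurable (sigma_env_upto M e n)"
    by (simp_all add: envA_def envB_def)
qed

lemma measurable_sigma_env_upto_Pi_R:
  shows "(\<lambda>\<omega>. Pi_env (env_of e \<omega>) n) \<in> borel_measurable (sigma_env_upto M e n)"
    and "(\<lambda>\<omega>. R_part (env_of e \<omega>) n) \<in> borel_measurable (sigma_env_upto M e n)"
  unfolding R_part_def R_term_def Pi_env_def
  by (auto intro!: borel_measurable_prod borel_measurable_sum borel_measurable_times
      measurable_sigma_env_upto_fst_snd)

lemma measurable_R_inf [measurable]: "R_inf \<in> borel_measurable env_space"
  unfolding R_inf_def[abs_def] R_term_def by measurable

section \<open>Quenched measures as kernels on environments\<close>

lemma quenched_measure_prob_space: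
  assumes "quenched_measure M e P"
  shows "prob_space (P \<eta>)" "sets (P \<eta>) = sets M"
proof -
  have "P \<eta> \<in> space (prob_algebra M)"
    using assms by (intro measurable_space[of P env_space]) (auto simp: quenched_measure_def space_PiM)
  then show "prob_space (P \<eta>)" "sets (P \<eta>) = sets M"
    by (auto simp: space_prob_algebra)
qed

text \<open>The defining identity holds for each event off a null set of its own. Countably many
  events suffice, because a countable base of open sets separates points; and for an event generated
  by the environment the conditional probability is its indicator.\<close>

lemma (in prob_space) AE_quenched_env:
  assumes e: "\<And>n. e n \<in> measurable M borel" and P: "quenched_measure M e P"
  shows "AE \<omega> in M. AE \<omega>' in P (env_of e \<omega>). env_of e \<omega>' = env_of e \<omega>"
proof -
  note [measurable] = e
  interpret G: finite_measure_subalgebra M "sigma_env M e"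
    by unfold_locales (rule subalgebra_sigma_env[OF e])
  obtain \<B> :: "(real \<times> real) set set" where \<B>: "countable \<B>" "topological_basis \<B>"
    using ex_countable_basis by blast
  have "AE \<omega> in M. e n \<omega> \<in> U \<longrightarrow> (AE \<omega>' in P (env_of e \<omega>). e n \<omega>' \<in> U)" if U: "U \<in> \<B>" for n U
  proof -
    define S where "S = {\<omega> \<in> space M. e n \<omega> \<in> U}"
    have [measurable]: "U \<in> sets borel"
      using topological_basis_open[OF \<B>(2) U] by simp
    have S: "S \<in> sets M"
      unfolding S_def by measurable
    have "S = e n -` U \<inter> space (sigma_env M e)"
      by (auto simp: S_def sigma_env_def)
    then have SG: "S \<in> sets (sigma_env M e)"
      using measurable_sets[OF measurable_sigma_env_component[where e = e and M = M and n = n], of U] by simp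
    have "AE \<omega> in M. real_cond_exp M (sigma_env M e) (indicator S) \<omega> = indicator S \<omega>"
    proof (rule G.real_cond_exp_F_meas)
      show "integrable M (indicator S :: _ \<Rightarrow> real)"
        using S by (intro bdd_integrable[where K = 1]) (auto simp: indicator_def)
      show "(indicator S :: _ \<Rightarrow> real) \<in> borel_measurable (sigma_env M e)"
        using SG by (rule borel_measurable_indicator)
    qed
    moreover have "AE \<omega> in M. real_cond_exp M (sigma_env M e) (indicator S) \<omega> = measure (P (env_of e \<omega>)) S"
      using P S by (simp add: quenched_measure_def)
    ultimately show ?thesis
      using AE_space
    proof eventually_elim
      case (elim \<omega>)
      show ?case
      proof
        assume "e n \<omega> \<in> U"
        with elim have 1: "measure (P (env_of e \<omega>)) S = 1"
          by (simp add: S_def)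
        interpret P: prob_space "P (env_of e \<omega>)"
          by (rule quenched_measure_prob_space[OF P])
        have "AE \<omega>' in P (env_of e \<omega>). \<omega>' \<in> S"
          using 1 S quenched_measure_prob_space(2)[OF P] by (subst P.prob_eq_1[symmetric]) auto
        then show "AE \<omega>' in P (env_of e \<omega>). e n \<omega>' \<in> U"
          by eventually_elim (simp add: S_def)
      qed
    qed
  qed
  then have "AE \<omega> in M. \<forall>n. \<forall>U\<in>\<B>. e n \<omega> \<in> U \<longrightarrow> (AE \<omega>' in P (env_of e \<omega>). e n \<omega>' \<in> U)"
    using \<B>(1) by (simp add: AE_all_countable AE_ball_countable)
  then show ?thesis
  proof eventually_elim
    case (elim \<omega>)
    have "AE \<omega>' in P (env_of e \<omega>). e n \<omega> \<in> U \<longrightarrow> e n \<omega>' \<in> U" if "U \<in> \<B>" for n U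
      using elim that by (cases "e n \<omega> \<in> U") auto
    then have "AE \<omega>' in P (env_of e \<omega>). \<forall>n. \<forall>U\<in>\<B>. e n \<omega> \<in> U \<longrightarrow> e n \<omega>' \<in> U"
      using \<B>(1) by (simp add: AE_all_countable AE_ball_countable)
    then show ?case
    proof eventually_elim
      case (elim \<omega>')
      have "e n \<omega>' = e n \<omega>" for n
      proof (rule ccontr)
        assume "e n \<omega>' \<noteq> e n \<omega>"
        then obtain O' where "O' \<in> \<B>" "e n \<omega> \<in> O'" "O' \<subseteq> - {e n \<omega>'}"
          using topological_basisE[OF \<B>(2), of "- {e n \<omega>'}" "e n \<omega>"] by auto
        with elim show False by blast
      qed
      then show ?case by simp
    qed
  qed
qed

lemma measurable_quenched_laplace:
  assumes "quenched_measure M e P" "W \<in> borel_measurable M"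
  shows "(\<lambda>\<eta>. quenched_laplace P W \<eta> u) \<in> borel_measurable env_space"
proof -
  have "P \<in> measurable env_space (subprob_algebra M)"
    using assms(1) by (auto simp: quenched_measure_def intro: measurable_prob_algebraD)
  moreover have "(\<lambda>\<omega>. exp (- u * W \<omega>)) \<in> borel_measurable M"
    using assms(2) by measurable
  ultimately show ?thesis
    unfolding quenched_laplace_def
    by (rule measurable_compose[OF _ integral_measurable_subprob_algebra])
qed

lemma tendsto_quenched_laplace:
  assumes P: "quenched_measure M e P" and W: "W \<in> borel_measurable M" "\<And>\<omega>. 0 \<le> W \<omega>"
    and u: "u \<longlonglongrightarrow> v" "\<And>n. 0 \<le> u n"
  shows "(\<lambda>n. quenched_laplace P W \<eta> (u n)) \<longlonglongrightarrow> quenched_laplace P W \<eta> v"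
proof -
  interpret prob_space "P \<eta>" by (rule quenched_measure_prob_space[OF P])
  have [measurable]: "W \<in> borel_measurable (P \<eta>)"
    using W by (simp add: measurable_cong_sets[OF quenched_measure_prob_space(2)[OF P] refl])
  show ?thesis
    unfolding quenched_laplace_def
  proof (rule integral_dominated_convergence[where w = "\<lambda>_. 1"])
    show "AE \<omega> in P \<eta>. (\<lambda>n. exp (- u n * W \<omega>)) \<longlonglongrightarrow> exp (- v * W \<omega>)"
      by (intro AE_I2 tendsto_intros u)
    show "AE \<omega> in P \<eta>. norm (exp (- u n * W \<omega>)) \<le> 1" for n
      using W(2) u(2) by auto
  qed auto
qed

text \<open>Equality of Laplace transforms at the countably many rational arguments transfers to the
  shifted environment; continuity extends it to all arguments.\<close>

lemma quenched_laplace_eqI: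
  assumes P: "quenched_measure M e P" and W: "W \<in> borel_measurable M" "\<And>\<omega>. 0 \<le> W \<omega>"
    and R: "0 < R"
    and eq: "\<And>r :: rat. 0 < r \<Longrightarrow> quenched_laplace P W \<eta> (of_rat r) = PF_pgf \<theta> 1 R (1 - of_rat r)"
    and v: "0 < v"
  shows "quenched_laplace P W \<eta> v = PF_pgf \<theta> 1 R (1 - v)"
proof -
  have "\<exists>r :: rat. v < of_rat r \<and> of_rat r < v + 1 / real (Suc n)" for n
    by (rule of_rat_dense) simp
  then obtain r :: "nat \<Rightarrow> rat" where r: "\<And>n. v < of_rat (r n)" "\<And>n. of_rat (r n) < v + 1 / real (Suc n)"
    by metis
  have lim: "(\<lambda>n. of_rat (r n)) \<longlonglongrightarrow> v"
  proof (rule tendsto_sandwich[OF _ _ tendsto_const[of v]])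
    show "(\<lambda>n. v + 1 / real (Suc n)) \<longlonglongrightarrow> v"
      using tendsto_add[OF tendsto_const[of v] LIMSEQ_inverse_real_of_nat] by (simp add: inverse_eq_divide)
  qed (use r in \<open>auto intro!: always_eventually less_imp_le simp del: of_nat_Suc\<close>)
  have pos: "0 < (of_rat (r n) :: real)" for n
    using r(1)[of n] v by linarith
  have "(\<lambda>n. quenched_laplace P W \<eta> (of_rat (r n))) \<longlonglongrightarrow> quenched_laplace P W \<eta> v"
    using pos by (intro tendsto_quenched_laplace[OF P W lim]) (auto intro: less_imp_le)
  moreover have "quenched_laplace P W \<eta> (of_rat (r n)) = 1 - (1 / of_rat (r n) powr \<theta> + R) powr (- 1 / \<theta>)" for n
    using eq[of "r n"] pos[of n] by (simp add: PF_pgf_def)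
  moreover have "(\<lambda>n. 1 - (1 / of_rat (r n) powr \<theta> + R) powr (- 1 / \<theta>)) \<longlonglongrightarrow> 1 - (1 / v powr \<theta> + R) powr (- 1 / \<theta>)"
  proof -
    have "0 < 1 / v powr \<theta> + R"
      using v R by (intro add_pos_pos) auto
    then show ?thesis
      using v by (intro tendsto_intros lim) auto
  qed
  ultimately have "quenched_laplace P W \<eta> v = 1 - (1 / v powr \<theta> + R) powr (- 1 / \<theta>)"
    using LIMSEQ_unique by simp
  then show ?thesis
    using v by (simp add: PF_pgf_def)
qed

locale PF_GWRE = prob_space M
  for M :: "'a measure" +
  fixes \<theta> :: real and e :: "nat \<Rightarrow> 'a \<Rightarrow> real \<times> real" and P :: "env \<Rightarrow> 'a measure"
    and X :: "nat \<Rightarrow> nat \<Rightarrow> 'a \<Rightarrow> nat"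
  assumes theta_pos: "0 < \<theta>"
    and iid: "iid_env M e"
    and env_pos: "\<And>n. AE \<omega> in M. fst (e n \<omega>) > 0 \<and> snd (e n \<omega>) > 0 \<and> fst (e n \<omega>) + snd (e n \<omega>) \<ge> 1"
    and quenched: "quenched_measure M e P"
    and X_meas: "\<And>n k. X n k \<in> measurable M (count_space UNIV)"
    and offspring: "AE \<omega> in M. PF_offspring \<theta> (env_of e \<omega>) (P (env_of e \<omega>)) X"
    and supercritical:
      "AE \<omega> in M. summable (R_term (env_of e \<omega>))"
      "AE \<omega> in M. \<not> summable (Rdual_term (env_of e \<omega>))"
begin

lemmas e_meas [measurable] = iid_env_measurable[OF prob_space_axioms iid]
lemmas env_meas [measurable] = measurable_env_of[OF e_meas]
lemmas AE_shift = AE_env_shift[OF prob_space_axioms iid]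

text \<open>The exceptional null sets are gathered here once, so that results for a fixed
  environment can be quoted under \<open>eventually_elim\<close>.\<close>

lemma AE_quenched_GW: "AE \<omega> in M. quenched_GW (P (env_of e \<omega>)) (env_of e \<omega>) M e X \<theta>"
proof -
  have "AE \<omega> in M. \<forall>n. fst (e n \<omega>) > 0 \<and> snd (e n \<omega>) > 0 \<and> fst (e n \<omega>) + snd (e n \<omega>) \<ge> 1"
    using env_pos by (simp add: AE_all_countable)
  from this offspring supercritical AE_quenched_env[OF e_meas quenched]
  show ?thesis
  proof eventually_elim
    case (elim \<omega>)
    show ?case
    proof (intro quenched_GW.intro quenched_GW_axioms.intro supercritical_env.intro)
    qed (use elim quenched_measure_prob_space[OF quenched] e_meas X_meas in \<open>auto simp: envA_def envB_def\<close>)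
  qed
qed

lemma AE_R_inf_pos: "AE \<omega> in M. 0 < R_inf (env_of e \<omega>)"
  using AE_quenched_GW
  by eventually_elim (simp add: quenched_GW_def supercritical_env.R_inf_pos)

lemma AE_R_inf_shift_pos: "AE \<omega> in M. 0 < R_inf (env_shift (env_of e \<omega>))"
  by (rule AE_shift[where Q = "\<lambda>\<eta>. 0 < R_inf \<eta>", OF _ AE_R_inf_pos]) measurable

lemma AE_R_inf_rec:
  "AE \<omega> in M. R_inf (env_of e \<omega>) =
    envA (env_of e \<omega>) 0 * R_inf (env_shift (env_of e \<omega>)) + envB (env_of e \<omega>) 0"
  using AE_quenched_GW
  by eventually_elim (simp add: quenched_GW_def supercritical_env.R_inf_shift)

text \<open>The kernel conditions on the whole environment, the extinction probability on the first
  \<open>n\<close> pairs only. The quenched value is a function of these pairs, so the tower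
  property carries it unchanged to the smaller sigma-algebra.\<close>

lemma extinction_cond_exp:
  "AE \<omega> in M. real_cond_exp M (sigma_env_upto M e n) (indicator {\<omega>' \<in> space M. GW X n \<omega>' = 0}) \<omega>
    = 1 - (Pi_env (env_of e \<omega>) n + R_part (env_of e \<omega>) n) powr (- 1 / \<theta>)"
proof -
  let ?S = "{\<omega>' \<in> space M. GW X n \<omega>' = 0}" and ?G = "sigma_env M e" and ?F = "sigma_env_upto M e n"
  let ?g = "\<lambda>\<omega>. 1 - (Pi_env (env_of e \<omega>) n + R_part (env_of e \<omega>) n) powr (- 1 / \<theta>)"
  note [measurable] = measurable_GW[OF X_meas]
  have G: "subalgebra M ?G" and GF: "subalgebra ?G ?F"
    by (intro subalgebra_sigma_env e_meas subalgebra_sigma_env_upto)+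
  then have F: "subalgebra M ?F"
    by (auto simp: subalgebra_def)
  interpret G: finite_measure_subalgebra M ?G by unfold_locales (rule G)
  interpret F: finite_measure_subalgebra M ?F by unfold_locales (rule F)
  have g_F: "?g \<in> borel_measurable ?F"
    using measurable_sigma_env_upto_Pi_R[where e = e and M = M and n = n] by measurable
  have g_M: "?g \<in> borel_measurable M"
    by (rule measurable_from_subalg[OF F g_F])
  have g: "AE \<omega> in M. measure (P (env_of e \<omega>)) ?S = ?g \<omega>"
    using AE_quenched_GW by eventually_elim (rule quenched_GW.GW_extinct_prob)
  have int_S: "integrable M (indicator ?S :: _ \<Rightarrow> real)"
    by (intro bdd_integrable[where K = 1]) (auto simp: indicator_def)
  \<comment> \<open>The formula need not be bounded on exceptional environments; almost surely it is
    a probability.\<close>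
  have int_g: "integrable M ?g"
  proof (rule integrable_const_bound[where B = 1])
    show "AE \<omega> in M. norm (?g \<omega>) \<le> 1"
      using g
    proof eventually_elim
      case (elim \<omega>)
      interpret P: prob_space "P (env_of e \<omega>)"
        by (rule quenched_measure_prob_space[OF quenched])
      show ?case
        unfolding elim[symmetric] by simp
    qed
  qed (rule g_M)
  have "AE \<omega> in M. real_cond_exp M ?G (indicator ?S) \<omega> = measure (P (env_of e \<omega>)) ?S"
    using quenched by (simp add: quenched_measure_def)
  with g have "AE \<omega> in M. real_cond_exp M ?G (indicator ?S) \<omega> = ?g \<omega>"
    by eventually_elim simp
  then have "AE \<omega> in M. real_cond_exp M ?F (real_cond_exp M ?G (indicator ?S)) \<omega> = real_cond_exp M ?F ?g \<omega>"
    using g_M by (intro F.real_cond_exp_cong) auto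
  moreover have "AE \<omega> in M. real_cond_exp M ?F (real_cond_exp M ?G (indicator ?S)) \<omega> = real_cond_exp M ?F (indicator ?S) \<omega>"
    by (rule F.real_cond_exp_nested_subalg[OF G GF int_S])
  moreover have "AE \<omega> in M. real_cond_exp M ?F ?g \<omega> = ?g \<omega>"
    by (rule F.real_cond_exp_F_meas[OF int_g g_F])
  ultimately show ?thesis
    by eventually_elim simp
qed

lemma AE_extinction_lim:
  "AE \<omega> in M. (\<lambda>n. real_cond_exp M (sigma_env_upto M e n) (indicator {\<omega>' \<in> space M. GW X n \<omega>' = 0}) \<omega>)
    \<longlonglongrightarrow> 1 - R_inf (env_of e \<omega>) powr (- 1 / \<theta>)"
proof -
  have "AE \<omega> in M. \<forall>n. real_cond_exp M (sigma_env_upto M e n) (indicator {\<omega>' \<in> space M. GW X n \<omega>' = 0}) \<omega>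
    = 1 - (Pi_env (env_of e \<omega>) n + R_part (env_of e \<omega>) n) powr (- 1 / \<theta>)"
    using extinction_cond_exp by (simp add: AE_all_countable)
  from this AE_quenched_GW show ?thesis
  proof eventually_elim
    case (elim \<omega>)
    interpret supercritical_env "env_of e \<omega>"
      using elim(2) by (simp add: quenched_GW_def)
    show ?case
      using elim(1) tendsto_add[OF Pi_lim R_part_lim] R_inf_pos by (auto intro!: tendsto_intros)
  qed
qed

lemma ex_quenched_extinction_prob: "\<exists>q. quenched_extinction_prob M e X q"
proof
  show "quenched_extinction_prob M e X (\<lambda>\<eta>. 1 - R_inf \<eta> powr (- 1 / \<theta>))"
    unfolding quenched_extinction_prob_def using AE_extinction_lim by auto
qed

lemma quenched_extinction_prob_eq:
  assumes "quenched_extinction_prob M e X q"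
  shows "AE \<omega> in M. q (env_of e \<omega>) = 1 - R_inf (env_of e \<omega>) powr (- 1 / \<theta>)"
proof -
  have "AE \<omega> in M. (\<lambda>n. real_cond_exp M (sigma_env_upto M e n)
      (indicator {\<omega>' \<in> space M. GW X n \<omega>' = 0}) \<omega>) \<longlonglongrightarrow> q (env_of e \<omega>)"
    using assms by (simp add: quenched_extinction_prob_def)
  with AE_extinction_lim show ?thesis
    by eventually_elim (rule LIMSEQ_unique)
qed

lemma quenched_extinction_prob_less_1:
  assumes q: "quenched_extinction_prob M e X q"
  shows "measure M {\<omega> \<in> space M. q (env_of e \<omega>) < 1} = 1"
proof -
  have [measurable]: "q \<in> borel_measurable env_space"
    using q by (simp add: quenched_extinction_prob_def)
  have "AE \<omega> in M. q (env_of e \<omega>) < 1"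
    using quenched_extinction_prob_eq[OF q] AE_R_inf_pos by eventually_elim simp
  then show ?thesis
    by (subst prob_Collect_eq_1) auto
qed

text \<open>The explicit formula for \<open>q\<close> at the shifted environment comes from equality
  of laws, which is where measurability of \<open>q\<close> is used; the rest is
  \<open>R_inf_shift\<close>.\<close>

lemma quenched_extinction_prob_rec:
  assumes q: "quenched_extinction_prob M e X q"
  shows "AE \<omega> in M. 1 / (1 - q (env_of e \<omega>)) powr \<theta> =
    envA (env_of e \<omega>) 0 / (1 - q (env_shift (env_of e \<omega>))) powr \<theta> + envB (env_of e \<omega>) 0"
proof -
  have [measurable]: "q \<in> borel_measurable env_space"
    using q by (simp add: quenched_extinction_prob_def)
  have "AE \<omega> in M. q (env_shift (env_of e \<omega>)) = 1 - R_inf (env_shift (env_of e \<omega>)) powr (- 1 / \<theta>)"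
    by (rule AE_shift[where Q = "\<lambda>\<eta>. q \<eta> = 1 - R_inf \<eta> powr (- 1 / \<theta>)",
          OF _ quenched_extinction_prob_eq[OF q]]) measurable
  with quenched_extinction_prob_eq[OF q] AE_R_inf_pos AE_R_inf_shift_pos AE_R_inf_rec
  show ?thesis
    by eventually_elim (simp add: powr_neg_inverse_powr[OF _ theta_pos, simplified])
qed

section \<open>The limit and its Laplace transform at the shifted environment\<close>

abbreviation W :: "'a \<Rightarrow> real" where
  "W \<equiv> W_lim \<theta> e X"

lemma W_meas [measurable]: "W \<in> borel_measurable M"
  by (intro measurable_W_lim measurable_from_subalg[OF subalgebra_GW_filtration measurable_GW_filtration_W_proc]
      e_meas X_meas)

lemma AE_laplace:
  assumes "0 < u"
  shows "AE \<omega> in M. quenched_laplace P W (env_of e \<omega>) u = PF_pgf \<theta> 1 (R_inf (env_of e \<omega>)) (1 - u)"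
  using AE_quenched_GW
  by eventually_elim (simp only: quenched_laplace_def quenched_GW.W_laplace[OF _ assms])

lemma AE_laplace_shift:
  "AE \<omega> in M. \<forall>u>0. quenched_laplace P W (env_shift (env_of e \<omega>)) u
    = PF_pgf \<theta> 1 (R_inf (env_shift (env_of e \<omega>))) (1 - u)"
proof -
  have "AE \<omega> in M. quenched_laplace P W (env_shift (env_of e \<omega>)) u
    = PF_pgf \<theta> 1 (R_inf (env_shift (env_of e \<omega>))) (1 - u)" if u: "0 < u" for u
  proof (rule AE_shift[where Q = "\<lambda>\<eta>. quenched_laplace P W \<eta> u = PF_pgf \<theta> 1 (R_inf \<eta>) (1 - u)",
        OF _ AE_laplace[OF u]])
    have "(\<lambda>\<eta>. PF_pgf \<theta> 1 (R_inf \<eta>) (1 - u)) \<in> borel_measurable env_space"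
      unfolding PF_pgf_def using u by simp
    with measurable_quenched_laplace[OF quenched W_meas]
    show "{\<eta> \<in> space env_space. quenched_laplace P W \<eta> u = PF_pgf \<theta> 1 (R_inf \<eta>) (1 - u)} \<in> sets env_space"
      by (rule borel_measurable_eq)
  qed
  then have "AE \<omega> in M. 0 < r \<longrightarrow> quenched_laplace P W (env_shift (env_of e \<omega>)) (of_rat r)
    = PF_pgf \<theta> 1 (R_inf (env_shift (env_of e \<omega>))) (1 - of_rat r)" for r :: rat
    by (cases "0 < r") simp_all
  then have "AE \<omega> in M. \<forall>r :: rat. 0 < r \<longrightarrow> quenched_laplace P W (env_shift (env_of e \<omega>)) (of_rat r)
    = PF_pgf \<theta> 1 (R_inf (env_shift (env_of e \<omega>))) (1 - of_rat r)"
    unfolding AE_all_countable by blast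
  with AE_R_inf_shift_pos show ?thesis
  proof eventually_elim
    case (elim \<omega>)
    show ?case
    proof (intro allI impI)
      fix u :: real assume "0 < u"
      show "quenched_laplace P W (env_shift (env_of e \<omega>)) u
          = PF_pgf \<theta> 1 (R_inf (env_shift (env_of e \<omega>))) (1 - u)"
        by (rule quenched_laplace_eqI[OF quenched W_meas W_lim_nonneg])
           (use elim \<open>0 < u\<close> in simp_all)
    qed
  qed
qed

lemma AE_laplace_rec:
  "AE \<omega> in M. \<forall>u\<ge>0. quenched_laplace P W (env_of e \<omega>) u =
    PF_pgf \<theta> (envA (env_of e \<omega>) 0) (envB (env_of e \<omega>) 0)
      (quenched_laplace P W (env_shift (env_of e \<omega>)) (envA (env_of e \<omega>) 0 powr (1 / \<theta>) * u))"
  using AE_quenched_GW AE_laplace_shift AE_R_inf_shift_pos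
proof eventually_elim
  case (elim \<omega>)
  interpret Q: quenched_GW "P (env_of e \<omega>)" "env_of e \<omega>" M e X \<theta>
    by (rule elim(1))
  let ?A = "envA (env_of e \<omega>) 0" and ?B = "envB (env_of e \<omega>) 0" and ?R' = "R_inf (env_shift (env_of e \<omega>))"
  show ?case
  proof (intro allI impI)
    fix u :: real assume "0 \<le> u"
    show "quenched_laplace P W (env_of e \<omega>) u =
      PF_pgf \<theta> ?A ?B (quenched_laplace P W (env_shift (env_of e \<omega>)) (?A powr (1 / \<theta>) * u))"
    proof (cases "u = 0")
      case True
      interpret P': prob_space "P (env_shift (env_of e \<omega>))"
        by (rule quenched_measure_prob_space[OF quenched])
      show ?thesis
        using True by (simp add: quenched_laplace_def PF_pgf_def Q.prob_space P'.prob_space)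
    next
      case False
      with \<open>0 \<le> u\<close> have u: "0 < u" by simp
      let ?v = "?A powr (1 / \<theta>) * u"
      have v: "0 < ?v" using u Q.A_pos[of 0] by simp
      have v_powr: "?v powr \<theta> = ?A * u powr \<theta>"
        using u Q.A_pos[of 0] theta_pos by (simp add: powr_mult powr_powr)
      have "PF_pgf \<theta> ?A ?B (quenched_laplace P W (env_shift (env_of e \<omega>)) ?v)
          = PF_pgf \<theta> ?A ?B (PF_pgf \<theta> 1 ?R' (1 - ?v))"
        using elim(2) v by simp
      also have "\<dots> = PF_pgf \<theta> (?A * 1) (?B + ?A * ?R') (1 - ?v)"
        using elim(3) v theta_pos by (intro PF_pgf_compose) auto
      \<comment> \<open>The rescaled argument puts a factor \<open>?A\<close> into
        \<open>?v powr \<theta>\<close>, which cancels the slope \<open>?A\<close>; the intercept is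
        \<open>R_inf (env_of e \<omega>)\<close> by the shift identity.\<close>
      also have "\<dots> = PF_pgf \<theta> 1 (R_inf (env_of e \<omega>)) (1 - u)"
        using u v Q.A_pos[of 0] by (simp add: PF_pgf_def v_powr Q.R_inf_shift add.commute)
      finally show ?thesis
        using Q.W_laplace[OF u] by (simp add: quenched_laplace_def)
    qed
  qed
qed

end

theorem theorem6p1:
  fixes M :: "'a measure"
    and \<theta> :: real
    and e :: "nat \<Rightarrow> 'a \<Rightarrow> real \<times> real"
    and P :: "env \<Rightarrow> 'a measure"
    and X :: "nat \<Rightarrow> nat \<Rightarrow> 'a \<Rightarrow> nat"
  assumes prob: "prob_space M"
    and theta: "0 < \<theta>" "\<theta> \<le> 1"
    and iid: "iid_env M e"
    and env_pos: "\<And>n. AE \<omega> in M. fst (e n \<omega>) > 0 \<and> snd (e n \<omega>) > 0 \<and> fst (e n \<omega>) + snd (e n \<omega>) \<ge> 1"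
    and quenched: "quenched_measure M e P"
    and X_meas: "\<And>n k. X n k \<in> measurable M (count_space UNIV)"
    and offspring: "AE \<omega> in M. PF_offspring \<theta> (env_of e \<omega>) (P (env_of e \<omega>)) X"
    and supercritical:
      "AE \<omega> in M. summable (R_term (env_of e \<omega>))"
      "AE \<omega> in M. \<not> summable (Rdual_term (env_of e \<omega>))"
  shows
    "((\<exists>q. quenched_extinction_prob M e X q) \<and>
      (\<forall>q. quenched_extinction_prob M e X q \<longrightarrow>
        (AE \<omega> in M. q (env_of e \<omega>) = 1 - R_inf (env_of e \<omega>) powr (- 1 / \<theta>)) \<and>
        measure M {\<omega> \<in> space M. q (env_of e \<omega>) < 1} = 1 \<and>
        (AE \<omega> in M.
           1 / (1 - q (env_of e \<omega>)) powr \<theta> =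
             envA (env_of e \<omega>) 0 / (1 - q (env_shift (env_of e \<omega>))) powr \<theta> + envB (env_of e \<omega>) 0)))
     \<and>
     (AE \<omega> in M.
        is_martingale (P (env_of e \<omega>)) (GW_filtration M e X) (W_proc \<theta> e X) \<and>
        (\<forall>n. AE \<omega>' in P (env_of e \<omega>). W_proc \<theta> e X n \<omega>' \<ge> 0) \<and>
        (\<forall>n. (\<integral>\<omega>'. W_proc \<theta> e X n \<omega>' \<partial>P (env_of e \<omega>)) = 1))
     \<and>
     (\<exists>W \<in> borel_measurable M.
        (AE \<omega> in M.
           (AE \<omega>' in P (env_of e \<omega>). (\<lambda>n. W_proc \<theta> e X n \<omega>') \<longlonglongrightarrow> W \<omega>') \<and>
           integrable (P (env_of e \<omega>)) W \<and>
           (\<lambda>n. \<integral>\<omega>'. \<bar>W_proc \<theta> e X n \<omega>' - W \<omega>'\<bar> \<partial>P (env_of e \<omega>)) \<longlonglongrightarrow> 0 \<and>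
           CPF_law \<theta> 1 (R_inf (env_of e \<omega>)) (distr (P (env_of e \<omega>)) borel W) \<and>
           (\<forall>u\<ge>0. quenched_laplace P W (env_of e \<omega>) u =
              (if u = 0 then 1
               else 1 - (1 / u powr \<theta> + R_inf (env_of e \<omega>)) powr (- 1 / \<theta>)))) \<and>
        (AE \<omega> in M. \<forall>u\<ge>0.
           quenched_laplace P W (env_of e \<omega>) u =
             PF_pgf \<theta> (envA (env_of e \<omega>) 0) (envB (env_of e \<omega>) 0)
               (quenched_laplace P W (env_shift (env_of e \<omega>)) (envA (env_of e \<omega>) 0 powr (1 / \<theta>) * u))))"
proof -
  interpret PF_GWRE M \<theta> e P X
    by (intro PF_GWRE.intro PF_GWRE_axioms.intro assms)
  have mart: "AE \<omega> in M.
      is_martingale (P (env_of e \<omega>)) (GW_filtration M e X) (W_proc \<theta> e X) \<and>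
      (\<forall>n. AE \<omega>' in P (env_of e \<omega>). W_proc \<theta> e X n \<omega>' \<ge> 0) \<and>
      (\<forall>n. (\<integral>\<omega>'. W_proc \<theta> e X n \<omega>' \<partial>P (env_of e \<omega>)) = 1)"
    using AE_quenched_GW
    by eventually_elim
       (simp add: quenched_GW.W_proc_martingale quenched_GW.W_proc_mean W_proc_nonneg)
  have lim: "AE \<omega> in M.
      (AE \<omega>' in P (env_of e \<omega>). (\<lambda>n. W_proc \<theta> e X n \<omega>') \<longlonglongrightarrow> W \<omega>') \<and>
      integrable (P (env_of e \<omega>)) W \<and>
      (\<lambda>n. \<integral>\<omega>'. \<bar>W_proc \<theta> e X n \<omega>' - W \<omega>'\<bar> \<partial>P (env_of e \<omega>)) \<longlonglongrightarrow> 0 \<and>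
      CPF_law \<theta> 1 (R_inf (env_of e \<omega>)) (distr (P (env_of e \<omega>)) borel W) \<and>
      (\<forall>u\<ge>0. quenched_laplace P W (env_of e \<omega>) u =
        (if u = 0 then 1
         else 1 - (1 / u powr \<theta> + R_inf (env_of e \<omega>)) powr (- 1 / \<theta>)))"
    using AE_quenched_GW
  proof eventually_elim
    case (elim \<omega>)
    then show ?case
      unfolding quenched_laplace_def
      by (intro conjI allI impI quenched_GW.AE_W_proc_tendsto quenched_GW.W_integrable
          quenched_GW.W_proc_L1 quenched_GW.W_CPF_law quenched_GW.W_laplace')
  qed
  show ?thesis
    using ex_quenched_extinction_prob quenched_extinction_prob_eq quenched_extinction_prob_less_1
      quenched_extinction_prob_rec mart lim AE_laplace_rec W_meas
    by (intro conjI allI impI bexI[of _ W])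
qed

end
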